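(* Let $X$ and $Y$ be cellular spaces with $X$ compact, and let $a,b\colon X\to Y$ be based maps such that $a$ is $1$-similar to $b$ ($a\overset{1}{\sim}b$). Then $a$ is strongly $1$-similar to $b$ ($a\overset{1}{\approx}b$).
   Context: Conventions: a cellular space is a based CW complex; spaces and maps are based unless called unbased. For a set $W$, $\langle W\rangle$ is the free abelian group with basis $\{\langle w\rangle: w\in W\}$ (its elements are called ensembles); a function $f$ induces the homomorphism $\langle f\rangle$. For spaces $X,Y$ with $X$ compact Hausdorff, $Y^X$ is the space (compact-open topology) of based maps $X\to Y$, based at the constant map; $Y^X_a$ is the path component of $a$. For $R\subseteq X$ containing the basepoint, $V\mapsto V|_R$ denotes the homomorphism $\langle Y^X\rangle\to\langle Y^R\rangle$ induced by restriction. $\mathcal F_n(X)$ is the set of finite subsets $R\subseteq X$ containing the basepoint with $|R|\le n+1$. For $s\ge0$, $\langle Y^X\rangle^{(s)}$ is the subgroup of those $V\in\langle Y^X\rangle$ with $V|_R=0$ for all $R\in\mathcal F_{s-1}(X)$. $r$-similarity: $a\overset{r}{\sim}b$ iff there is $A\in\langle Y^X_a\rangle$ with $\langle b\rangle-A\in\langle Y^X\rangle^{(r+1)}$. Strong similarity: for unbased spaces $U,V$, $V^{(U)}$ is the space of unbased maps $U\to V$ and $\Xi^U\colon V\to V^{(U)}$ sends $v$ to the constant map at $v$. If $U=\coprod_{i\in(m)}U_i$ (disjoint union, $(m)=\{1,\dots,m\}$, $m\ge 0$), the combining product $\boxed{\sqcup}\colon\prod_i\langle V^{(U_i)}\rangle\to\langle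 V^{(U)}\rangle$ is the $\mathbb Z$-multilinear map with $\boxed{\sqcup}_i\langle w_i\rangle=\langle w\rangle$, $w|_{U_i}=w_i$. For a nonempty finite set $E$, $\Delta E$ is the simplex spanned by $E$, and $\Delta F\subseteq\Delta E$ is the face for nonempty $F\subseteq E$. A layout is a set $A$ of pairwise disjoint nonempty subsets of $E$; put $\Delta[A]=\coprod_{F\in A}\Delta F\subseteq\Delta E$. An ensemble $S\in\langle V^{(\Delta E)}\rangle$ is fissile if $S|_{\Delta[A]}=\boxed{\sqcup}_{F\in A}S|_{\Delta F}$ in $\langle V^{(\Delta[A])}\rangle$ for every layout $A$. For an unbased space $U$ and compact Hausdorff $X$ with basepoint $x_0$, let $U\wr X=(U\times X)/(U\times\{x_0\})$ (based at the collapsed set), and let $\#^X\colon (Y^X)^{(U)}\to Y^{U\wr X}$ be the bijection $\#^X(w)(u\wr x)=w(u)(x)$; put $\langle (Y^X)^{(U)}\rangle^{(s)}_X=\langle\#^X\rangle^{-1}(\langle Y^{U\wr X}\rangle^{(s)})$. For cellular $X,Y$, $X$ compact, $r\ge0$: $a\overset{r}{\approx}b$ iff for every nonempty finite set $E$ there is a fissile $S\in\langle (Y^X_a)^{(\Delta E)}\rangle\subseteq\langle (Y^X)^{(\Delta E)}\rangle$ with $\langle\Xi^{\Delta E}(b)\rangle-S\in\langle (Y^X)^{(\Delta E)}\rangle^{(r+1)}_X$. *)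

theory Defs
  imports "HOL-Analysis.Analysis"
begin

section \<open>Euclidean discs (points of R^n as nat => real vanishing from n on)\<close>

definition disc :: "nat \<Rightarrow> (nat \<Rightarrow> real) set" where
  "disc n = {x. (\<forall>i\<ge>n. x i = 0) \<and> (\<Sum>i<n. (x i)\<^sup>2) \<le> 1}"

definition open_disc :: "nat \<Rightarrow> (nat \<Rightarrow> real) set" where
  "open_disc n = {x. (\<forall>i\<ge>n. x i = 0) \<and> (\<Sum>i<n. (x i)\<^sup>2) < 1}"

definition bdry_sphere :: "nat \<Rightarrow> (nat \<Rightarrow> real) set" where
  "bdry_sphere n = {x. (\<forall>i\<ge>n. x i = 0) \<and> (\<Sum>i<n. (x i)\<^sup>2) = 1}"

definition cw_structure ::
  "'a topology \<Rightarrow> 'a set set \<Rightarrow> ('a set \<Rightarrow> nat) \<Rightarrow> ('a set \<Rightarrow> (nat \<Rightarrow> real) \<Rightarrow> 'a) \<Rightarrow> bool" where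
  "cw_structure X C cdim Phi \<longleftrightarrow>
     Hausdorff_space X \<and>
     pairwise disjnt C \<and> {} \<notin> C \<and> \<Union>C = topspace X \<and>
     (\<forall>e\<in>C.
        continuous_map (subtopology euclidean (disc (cdim e))) X (Phi e) \<and>
        Phi e ` open_disc (cdim e) = e \<and>
        homeomorphic_map (subtopology euclidean (open_disc (cdim e))) (subtopology X e) (Phi e) \<and>
        (\<exists>F. finite F \<and> F \<subseteq> C \<and> (\<forall>e'\<in>F. cdim e' < cdim e) \<and>
             Phi e ` bdry_sphere (cdim e) \<subseteq> \<Union>F)) \<and>
     (\<forall>S. S \<subseteq> topspace X \<longrightarrow>
        (closedin X S \<longleftrightarrow>
          (\<forall>e\<in>C. closedin (subtopology euclidean (disc (cdim e)))
                            {x \<in> disc (cdim e). Phi e x \<in> S})))"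

definition cellular :: "'a topology \<Rightarrow> 'a \<Rightarrow> bool" where
  "cellular X x0 \<longleftrightarrow>
     (\<exists>C cdim Phi. cw_structure X C cdim Phi \<and> {x0} \<in> C \<and> cdim {x0} = 0)"

text \<open>Maps are represented extensionally (undefined outside the topspace of the domain).\<close>

definition based_maps :: "'a topology \<Rightarrow> 'a \<Rightarrow> 'b topology \<Rightarrow> 'b \<Rightarrow> ('a \<Rightarrow> 'b) set" where
  "based_maps X x0 Y y0 =
     {f. continuous_map X Y f \<and> f x0 = y0 \<and> f \<in> extensional (topspace X)}"

definition unbased_maps :: "'u topology \<Rightarrow> 'v topology \<Rightarrow> ('u \<Rightarrow> 'v) set" where
  "unbased_maps U V = {f. continuous_map U V f \<and> f \<in> extensional (topspace U)}"

definition compact_open :: "'a topology \<Rightarrow> 'a \<Rightarrow> 'b topology \<Rightarrow> 'b \<Rightarrow> ('a \<Rightarrow> 'b) topology" where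
  "compact_open X x0 Y y0 =
     topology_generated_by
       (insert (based_maps X x0 Y y0)
          {{f \<in> based_maps X x0 Y y0. f ` K \<subseteq> U} | K U. compactin X K \<and> openin Y U})"

definition map_pc :: "'a topology \<Rightarrow> 'a \<Rightarrow> 'b topology \<Rightarrow> 'b \<Rightarrow> ('a \<Rightarrow> 'b) \<Rightarrow> ('a \<Rightarrow> 'b) set" where
  "map_pc X x0 Y y0 a = path_component_of_set (compact_open X x0 Y y0) a"

section \<open>Ensembles: the free abelian group on a set, as finitely supported integer functions\<close>

definition ens :: "'w set \<Rightarrow> ('w \<Rightarrow> int) set" where
  "ens W = {c. finite {w. c w \<noteq> 0} \<and> {w. c w \<noteq> 0} \<subseteq> W}"

definition gen :: "'w \<Rightarrow> 'w \<Rightarrow> int" where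
  "gen w = (\<lambda>v. if v = w then 1 else 0)"

definition push :: "('w \<Rightarrow> 'v) \<Rightarrow> ('w \<Rightarrow> int) \<Rightarrow> 'v \<Rightarrow> int" where
  "push f c = (\<lambda>v. \<Sum>w\<in>{w. c w \<noteq> 0 \<and> f w = v}. c w)"

definition restr :: "'a set \<Rightarrow> (('a \<Rightarrow> 'b) \<Rightarrow> int) \<Rightarrow> ('a \<Rightarrow> 'b) \<Rightarrow> int" where
  "restr R V = push (\<lambda>f. restrict f R) V"

text \<open>The subgroup <Y^X>^(s): V|_R = 0 for all R in F_(s-1)(X), i.e. finite R containing
the basepoint with |R| <= s.\<close>

definition ens_filt :: "'a topology \<Rightarrow> 'a \<Rightarrow> 'b topology \<Rightarrow> 'b \<Rightarrow> nat \<Rightarrow> (('a \<Rightarrow> 'b) \<Rightarrow> int) set" where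
  "ens_filt X x0 Y y0 s =
     {V \<in> ens (based_maps X x0 Y y0).
        \<forall>R. finite R \<and> R \<subseteq> topspace X \<and> x0 \<in> R \<and> card R \<le> s \<longrightarrow> restr R V = (\<lambda>_. 0)}"

definition similar :: "'a topology \<Rightarrow> 'a \<Rightarrow> 'b topology \<Rightarrow> 'b \<Rightarrow> nat \<Rightarrow> ('a \<Rightarrow> 'b) \<Rightarrow> ('a \<Rightarrow> 'b) \<Rightarrow> bool" where
  "similar X x0 Y y0 r a b \<longleftrightarrow>
     (\<exists>A \<in> ens (map_pc X x0 Y y0 a). (\<lambda>w. gen b w - A w) \<in> ens_filt X x0 Y y0 (r + 1))"

text \<open>The simplex_of spanned by a finite set E of naturals (barycentric coordinates); for
F a subset of E, simplex_of F is the face of simplex_of E spanned by F.\<close>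

definition simplex_of :: "nat set \<Rightarrow> (nat \<Rightarrow> real) set" where
  "simplex_of E = {t. (\<forall>e\<in>E. 0 \<le> t e) \<and> (\<forall>e. e \<notin> E \<longrightarrow> t e = 0) \<and> sum t E = 1}"

definition simplex_top :: "nat set \<Rightarrow> (nat \<Rightarrow> real) topology" where
  "simplex_top E = subtopology euclidean (simplex_of E)"

definition layout :: "nat set \<Rightarrow> nat set set \<Rightarrow> bool" where
  "layout E A \<longleftrightarrow> (\<forall>F\<in>A. F \<noteq> {} \<and> F \<subseteq> E) \<and> pairwise disjnt A"

definition layout_set :: "nat set set \<Rightarrow> (nat \<Rightarrow> real) set" where
  "layout_set A = \<Union> (simplex_of ` A)"

text \<open>Combining product: the multilinear map with <w_F>_F |-> <w>, w|_(Delta F) = w_F.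
Written out coefficientwise.\<close>

definition combine :: "nat set set \<Rightarrow> (nat set \<Rightarrow> ((nat \<Rightarrow> real) \<Rightarrow> 'v) \<Rightarrow> int)
                       \<Rightarrow> ((nat \<Rightarrow> real) \<Rightarrow> 'v) \<Rightarrow> int" where
  "combine A S = (\<lambda>w. if w \<in> extensional (layout_set A)
                       then (\<Prod>F\<in>A. S F (restrict w (simplex_of F))) else 0)"

definition fissile :: "nat set \<Rightarrow> (((nat \<Rightarrow> real) \<Rightarrow> 'v) \<Rightarrow> int) \<Rightarrow> bool" where
  "fissile E S \<longleftrightarrow>
     (\<forall>A. layout E A \<longrightarrow> restr (layout_set A) S = combine A (\<lambda>F. restr (simplex_of F) S))"

text \<open>Points of U wr X: None is the collapsed basepoint, Some (u,x) with x not the basepoint.\<close>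

definition wr_pts :: "'u topology \<Rightarrow> 'a topology \<Rightarrow> 'a \<Rightarrow> ('u \<times> 'a) option set" where
  "wr_pts U X x0 = insert None {Some (u, x) | u x. u \<in> topspace U \<and> x \<in> topspace X \<and> x \<noteq> x0}"

definition wr_quot :: "'a \<Rightarrow> 'u \<times> 'a \<Rightarrow> ('u \<times> 'a) option" where
  "wr_quot x0 p = (if snd p = x0 then None else Some p)"

definition wr_top :: "'u topology \<Rightarrow> 'a topology \<Rightarrow> 'a \<Rightarrow> ('u \<times> 'a) option topology" where
  "wr_top U X x0 = topology (\<lambda>S. S \<subseteq> wr_pts U X x0 \<and>
      openin (prod_topology U X) {p \<in> topspace (prod_topology U X). wr_quot x0 p \<in> S})"

definition sharp :: "'u topology \<Rightarrow> 'a topology \<Rightarrow> 'a \<Rightarrow> 'b \<Rightarrow> ('u \<Rightarrow> 'a \<Rightarrow> 'b)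
                     \<Rightarrow> ('u \<times> 'a) option \<Rightarrow> 'b" where
  "sharp U X x0 y0 w = restrict (\<lambda>p. case p of None \<Rightarrow> y0 | Some (u, x) \<Rightarrow> w u x) (wr_pts U X x0)"

definition ens_filt_wr :: "'u topology \<Rightarrow> 'a topology \<Rightarrow> 'a \<Rightarrow> 'b topology \<Rightarrow> 'b \<Rightarrow> nat
                          \<Rightarrow> (('u \<Rightarrow> 'a \<Rightarrow> 'b) \<Rightarrow> int) set" where
  "ens_filt_wr U X x0 Y y0 s =
     {V \<in> ens (unbased_maps U (compact_open X x0 Y y0)).
        push (sharp U X x0 y0) V \<in> ens_filt (wr_top U X x0) None Y y0 s}"

definition const_map :: "'u topology \<Rightarrow> 'v \<Rightarrow> 'u \<Rightarrow> 'v" where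
  "const_map U v = restrict (\<lambda>_. v) (topspace U)"

definition strongly_similar ::
  "'a topology \<Rightarrow> 'a \<Rightarrow> 'b topology \<Rightarrow> 'b \<Rightarrow> nat \<Rightarrow> ('a \<Rightarrow> 'b) \<Rightarrow> ('a \<Rightarrow> 'b) \<Rightarrow> bool" where
  "strongly_similar X x0 Y y0 r a b \<longleftrightarrow>
     (\<forall>E::nat set. finite E \<and> E \<noteq> {} \<longrightarrow>
        (\<exists>S \<in> ens (unbased_maps (simplex_top E)
                      (subtopology (compact_open X x0 Y y0) (map_pc X x0 Y y0 a))).
           fissile E S \<and>
           (\<lambda>w. gen (const_map (simplex_top E) b) w - S w)
              \<in> ens_filt_wr (simplex_top E) X x0 Y y0 (r + 1)))"

end

theory Submission
  imports Defs
begin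

text \<open>Let \<open>A\<close> be the ensemble that witnesses the 1-similarity, with support \<open>I\<close>, and join \<open>a\<close> to each
  \<open>v \<in> I\<close> by a path. An equivalence relation \<open>Q\<close> on \<open>E\<close> and a labelling \<open>i\<close> of its classes by
  elements of \<open>I\<close> give a family over the simplex: on the face of a class it is constantly the label
  of the class, and away from these faces it retreats to \<open>a\<close> along the paths. Let \<open>\<lambda>\<^sub>R\<close> be the signed
  law of labellings with independent \<open>A\<close>-distributed labels on the classes of \<open>R\<close>, and define
  \<open>\<kappa>\<^sub>Q\<close> by \<open>\<lambda>\<^sub>R = (\<Sum>Q \<supseteq> R. \<kappa>\<^sub>Q)\<close>. The ensemble of all families weighted by \<open>\<kappa>\<^sub>Q(i)\<close> is fissile,
  because restriction of relations to disjoint faces has a left adjoint (extension by singletons)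
  along which \<open>\<lambda>\<close> is multiplicative. At a single point of the simplex only one label
  matters, and the marginal of \<open>\<lambda>\<^sub>R\<close> at one label is \<open>A\<close> for every \<open>R\<close>; by Moebius inversion that of
  \<open>\<kappa>\<^sub>Q\<close> vanishes unless \<open>Q\<close> is the full relation, so the ensemble looks there like the constant
  families with values in \<open>A\<close>, which agree with \<open>b\<close> at every point of \<open>X\<close>.\<close>

section \<open>Moebius inversion over a finite set\<close>

text \<open>The system is triangular: an \<open>r0\<close> of maximal rank \<open>m\<close> lies
  above no other element of \<open>L\<close>, so \<open>k r0\<close> occurs only in the equation at
  \<open>r0\<close> and can be chosen last. The abstract \<open>le\<close> lets the lemma serve both
  inclusion and reverse inclusion.\<close>

lemma zeta_transform_surj:
  fixes l :: "'q \<Rightarrow> int" and m :: "'q \<Rightarrow> nat"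
  assumes "finite L" and refl: "\<And>r. le r r"
    and mono: "\<And>r q. r \<in> L \<Longrightarrow> q \<in> L \<Longrightarrow> le r q \<Longrightarrow> r \<noteq> q \<Longrightarrow> m q < m r"
  shows "\<exists>k. \<forall>r\<in>L. (\<Sum>q\<in>{q\<in>L. le r q}. k q) = l r"
  using assms(1) mono
proof (induction "card L" arbitrary: L)
  case 0
  then show ?case by auto
next
  case (Suc N)
  then have "L \<noteq> {}" by auto
  then have "Max (m ` L) \<in> m ` L" using Suc.prems(1) by simp
  then obtain r0 where r0: "r0 \<in> L" "m r0 = Max (m ` L)" by auto
  then have max: "m r \<le> m r0" if "r \<in> L" for r using Suc.prems(1) that by simp
  let ?L = "L - {r0}"
  have "\<exists>k. \<forall>r\<in>?L. (\<Sum>q\<in>{q\<in>?L. le r q}. k q) = l r"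
    using Suc r0 by (intro Suc.hyps(1)) (auto simp: card_Diff_singleton_if)
  then obtain k where k: "\<And>r. r \<in> ?L \<Longrightarrow> (\<Sum>q\<in>{q\<in>?L. le r q}. k q) = l r" by blast
  define k' where "k' = k(r0 := l r0 - (\<Sum>q\<in>{q\<in>?L. le r0 q}. k q))"
  have k'_eq: "(\<Sum>q\<in>{q\<in>?L. le r q}. k' q) = (\<Sum>q\<in>{q\<in>?L. le r q}. k q)" for r
    by (intro sum.cong) (auto simp: k'_def)
  have "(\<Sum>q\<in>{q\<in>L. le r q}. k' q) = l r" if "r \<in> L" for r
  proof (cases "r = r0")
    case True
    have "{q\<in>L. le r q} = insert r0 {q\<in>?L. le r0 q}" using True refl r0 by auto
    then show ?thesis using Suc.prems(1) True k'_eq[of r0] by (simp add: k'_def)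
  next
    case False
    have "{q\<in>L. le r q} = {q\<in>?L. le r q}"
      using False Suc.prems(2)[OF that r0(1)] max[OF that] by fastforce
    then show ?thesis using k[of r] False that k'_eq[of r] by simp
  qed
  then show ?case by blast
qed

text \<open>Induction on rank: the elements strictly above \<open>r\<close> have smaller rank, so
  their terms cancel. \<open>L\<close> is arbitrary so that inversion can also be done on an upward
  closed family of relations.\<close>

lemma zeta_transform_inj:
  fixes k k' :: "'q \<Rightarrow> int" and m :: "'q \<Rightarrow> nat"
  assumes "finite L" and refl: "\<And>r. le r r"
    and mono: "\<And>r q. r \<in> L \<Longrightarrow> q \<in> L \<Longrightarrow> le r q \<Longrightarrow> r \<noteq> q \<Longrightarrow> m q < m r"
    and eq: "\<And>r. r \<in> L \<Longrightarrow> (\<Sum>q\<in>{q\<in>L. le r q}. k q) = (\<Sum>q\<in>{q\<in>L. le r q}. k' q)"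
    and "r \<in> L"
  shows "k r = k' r"
  using assms(5)
proof (induction "m r" arbitrary: r rule: less_induct)
  case less
  let ?U = "{q\<in>L. le r q} - {r}"
  have "(\<Sum>q\<in>?U. k q) = (\<Sum>q\<in>?U. k' q)"
    using less mono by (intro sum.cong) auto
  moreover have "(\<Sum>q\<in>{q\<in>L. le r q}. f q) = f r + (\<Sum>q\<in>?U. f q)" for f :: "'q \<Rightarrow> int"
    using \<open>finite L\<close> less.prems refl by (intro sum.remove) auto
  ultimately show ?case using eq[OF less.prems] by simp
qed

section \<open>Random labels that are constant on equivalence classes\<close>

definition eqrels :: "'e set \<Rightarrow> ('e \<times> 'e) set set" where
  "eqrels E = {Q. equiv E Q}"

lemma eqrels_subset: "Q \<in> eqrels E \<Longrightarrow> Q \<subseteq> E \<times> E"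
  by (simp add: eqrels_def equiv_type)

lemma finite_eqrels: "finite E \<Longrightarrow> finite (eqrels E)"
  by (rule finite_subset[of _ "Pow (E \<times> E)"]) (auto dest: eqrels_subset)

lemma eqrels_full: "E \<times> E \<in> eqrels E"
  by (auto simp: eqrels_def equiv_def refl_on_def sym_def trans_def)

lemma eqrels_refl: "Q \<in> eqrels E \<Longrightarrow> e \<in> E \<Longrightarrow> (e, e) \<in> Q"
  by (auto simp: eqrels_def equiv_def refl_on_def)

lemma eqrels_sym: "Q \<in> eqrels E \<Longrightarrow> (e, f) \<in> Q \<Longrightarrow> (f, e) \<in> Q"
  by (auto simp: eqrels_def equiv_def sym_def)

lemma eqrels_trans: "Q \<in> eqrels E \<Longrightarrow> (e, f) \<in> Q \<Longrightarrow> (f, g) \<in> Q \<Longrightarrow> (e, g) \<in> Q"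
  unfolding eqrels_def equiv_def by (blast dest: transD)

lemma eqrels_restrict:
  assumes "Q \<in> eqrels E" "F \<subseteq> E"
  shows "Q \<inter> F \<times> F \<in> eqrels F"
proof -
  have "sym (Q \<inter> F \<times> F)" using eqrels_sym[OF assms(1)] by (intro symI) blast
  moreover have "trans (Q \<inter> F \<times> F)" using eqrels_trans[OF assms(1)] by (intro transI) blast
  moreover have "refl_on F (Q \<inter> F \<times> F)"
    using eqrels_refl[OF assms(1)] assms(2) by (auto simp: refl_on_def)
  ultimately show ?thesis by (simp add: eqrels_def equiv_def)
qed

text \<open>This is the smallest equivalence relation on \<open>E\<close> containing
  \<open>r\<close> and \<open>s\<close>. Since \<open>F\<close> and \<open>G\<close> are disjoint,
  transitivity never mixes the two.\<close>

lemma eqrels_extend: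
  assumes "r \<in> eqrels F" "s \<in> eqrels G" "F \<subseteq> E" "G \<subseteq> E" "F \<inter> G = {}"
  shows "r \<union> s \<union> Id_on E \<in> eqrels E"
proof -
  have "r \<subseteq> F \<times> F" "s \<subseteq> G \<times> G" using assms by (auto dest: eqrels_subset)
  then have "trans (r \<union> s \<union> Id_on E)"
    using assms(5) eqrels_trans[OF assms(1)] eqrels_trans[OF assms(2)]
    by (intro transI) blast
  moreover have "r \<union> s \<union> Id_on E \<subseteq> E \<times> E"
    using \<open>r \<subseteq> F \<times> F\<close> \<open>s \<subseteq> G \<times> G\<close> assms by auto
  moreover have "sym (r \<union> s \<union> Id_on E)"
    using eqrels_sym[OF assms(1)] eqrels_sym[OF assms(2)] by (intro symI) blast
  ultimately show ?thesis
    by (auto simp: eqrels_def equiv_def refl_on_def)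
qed

text \<open>The size of the complement is the rank for inclusion; the size itself, in the next
  lemma, is the rank for reverse inclusion.\<close>

lemma eqrels_rank_up:
  assumes "finite E" "r \<in> eqrels E" "q \<in> eqrels E" "r \<subseteq> q" "r \<noteq> q"
  shows "card (E \<times> E - q) < card (E \<times> E - r)"
proof (rule psubset_card_mono)
  show "E \<times> E - q \<subset> E \<times> E - r" using eqrels_subset[OF assms(3)] assms(4,5) by blast
qed (simp add: assms(1))

lemma eqrels_rank_down:
  assumes "finite E" "r \<in> eqrels E" "q \<subseteq> r" "r \<noteq> q"
  shows "card q < card r"
proof (rule psubset_card_mono)
  show "finite r" using eqrels_subset[OF assms(2)] assms(1) by (simp add: finite_subset)
qed (use assms in blast)

text \<open>The minimum depends only on the class as a set, so relations that share a class share
  its representative.\<close>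

definition class_rep :: "(nat \<times> nat) set \<Rightarrow> nat \<Rightarrow> nat" where
  "class_rep Q e = Min (Q `` {e})"

lemma class_rep_related:
  assumes "finite E" "Q \<in> eqrels E" "e \<in> E"
  shows "(e, class_rep Q e) \<in> Q"
proof -
  have "finite (Q `` {e})" "Q `` {e} \<noteq> {}"
    using assms eqrels_subset[OF assms(2)] eqrels_refl[OF assms(2,3)]
    by (auto intro: finite_subset[of _ E])
  then have "Min (Q `` {e}) \<in> Q `` {e}" by (rule Min_in)
  then show ?thesis by (simp add: class_rep_def)
qed

lemma class_rep_in: "finite E \<Longrightarrow> Q \<in> eqrels E \<Longrightarrow> e \<in> E \<Longrightarrow> class_rep Q e \<in> E"
  using class_rep_related[of E Q e] eqrels_subset[of Q E] by blast

lemma class_rep_eq: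
  assumes "Q \<in> eqrels E" "(e, f) \<in> Q"
  shows "class_rep Q e = class_rep Q f"
proof -
  have "Q `` {e} = Q `` {f}"
    using assms eqrels_sym[OF assms(1)] eqrels_trans[OF assms(1)] by blast
  then show ?thesis by (simp add: class_rep_def)
qed

text \<open>Turns labels on elements into labels on classes. Distinct classes read distinct
  coordinates of \<open>j\<close>, so independence of coordinates becomes independence of
  classes.\<close>

definition clone :: "nat set \<Rightarrow> (nat \<times> nat) set \<Rightarrow> (nat \<Rightarrow> 'v) \<Rightarrow> nat \<Rightarrow> 'v" where
  "clone E Q j = (\<lambda>e\<in>E. j (class_rep Q e))"

lemma clone_in_PiE:
  assumes "finite E" "Q \<in> eqrels E" "j \<in> E \<rightarrow>\<^sub>E I"
  shows "clone E Q j \<in> E \<rightarrow>\<^sub>E I"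
  unfolding clone_def
proof (intro PiE_I)
  fix e assume "e \<in> E"
  then show "(\<lambda>e\<in>E. j (class_rep Q e)) e \<in> I"
    using PiE_mem[OF assms(3) class_rep_in[OF assms(1,2)]] by simp
qed simp

lemma restrict_clone:
  assumes "finite F" "F \<subseteq> E" "r \<in> eqrels F" "\<And>e. e \<in> F \<Longrightarrow> R `` {e} = r `` {e}"
  shows "restrict (clone E R j) F = clone F r (restrict j F)"
  using assms class_rep_in[OF assms(1,3)]
  by (auto simp: clone_def class_rep_def restrict_def fun_eq_iff)

section \<open>Signed product laws and their images on class labellings\<close>

definition iid :: "('v \<Rightarrow> int) \<Rightarrow> nat set \<Rightarrow> (nat \<Rightarrow> 'v) \<Rightarrow> int" where
  "iid n E j = (\<Prod>e\<in>E. n (j e))"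

lemma sum_iid:
  assumes "finite E" "finite I" "(\<Sum>v\<in>I. n v) = 1"
  shows "(\<Sum>j\<in>E \<rightarrow>\<^sub>E I. iid n E j) = 1"
  using prod_sum_PiE[of E "\<lambda>_. I" "\<lambda>_. n"] assms by (simp add: iid_def)

lemma sum_PiE_split:
  assumes "F \<subseteq> E"
  shows "(\<Sum>j\<in>E \<rightarrow>\<^sub>E I. h (restrict j F) (restrict j (E - F))) =
    (\<Sum>p\<in>F \<rightarrow>\<^sub>E I. \<Sum>q\<in>(E - F) \<rightarrow>\<^sub>E I. h p q)"
proof -
  have "x \<notin> F" if "x \<notin> E" for x using assms that by blast
  then show ?thesis
    unfolding sum.cartesian_product
    by (intro sum.reindex_bij_witness[where
        i = "\<lambda>(p, q). \<lambda>e\<in>E. if e \<in> F then p e else q e" and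
        j = "\<lambda>j. (restrict j F, restrict j (E - F))"])
      (use assms in \<open>auto simp: PiE_iff extensional_def fun_eq_iff\<close>)
qed

lemma iid_split:
  assumes "finite E" "F \<subseteq> E"
  shows "iid n E j = iid n F (restrict j F) * iid n (E - F) (restrict j (E - F))"
  using prod.subset_diff[OF assms(2,1), of "\<lambda>e. n (j e)"] by (simp add: iid_def mult.commute)

text \<open>Splitting the coordinates into \<open>F\<close> and its complement, which contains
  \<open>G\<close>, factors the sum.\<close>

lemma iid_indep:
  assumes "finite E" "finite I" "(\<Sum>v\<in>I. n v) = 1" "F \<subseteq> E" "G \<subseteq> E" "F \<inter> G = {}"
  shows "(\<Sum>j\<in>E \<rightarrow>\<^sub>E I. iid n E j * (f (restrict j F) * g (restrict j G))) =
    (\<Sum>j\<in>E \<rightarrow>\<^sub>E I. iid n E j * f (restrict j F)) * (\<Sum>j\<in>E \<rightarrow>\<^sub>E I. iid n E j * g (restrict j G))"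
proof -
  define P where "P f = (\<Sum>p\<in>F \<rightarrow>\<^sub>E I. iid n F p * f p)" for f :: "(nat \<Rightarrow> 'a) \<Rightarrow> int"
  define H where "H g = (\<Sum>q\<in>(E - F) \<rightarrow>\<^sub>E I. iid n (E - F) q * g (restrict q G))"
    for g :: "(nat \<Rightarrow> 'a) \<Rightarrow> int"
  have G: "restrict (restrict j (E - F)) G = restrict j G" for j :: "nat \<Rightarrow> 'a"
    using assms by (auto simp: restrict_def fun_eq_iff)
  have main: "(\<Sum>j\<in>E \<rightarrow>\<^sub>E I. iid n E j * (f (restrict j F) * g (restrict j G))) = P f * H g" for f g
    using sum_PiE_split[OF assms(4), where I = I and
        h = "\<lambda>p q. iid n F p * iid n (E - F) q * (f p * g (restrict q G))"]
    unfolding G by (simp add: iid_split[OF assms(1,4)] P_def H_def sum_product mult_ac)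
  \<comment> \<open>Each block has total mass 1, so replacing one factor by 1 identifies the other
    with its own sum over all of \<open>E\<close>.\<close>
  have "P (\<lambda>_. 1) = 1" "H (\<lambda>_. 1) = 1"
    using sum_iid[of F I n] sum_iid[of "E - F" I n] assms
    by (auto simp: P_def H_def finite_subset)
  then show ?thesis
    using main[of f g] main[of f "\<lambda>_. 1"] main[of "\<lambda>_. 1" g] by simp
qed

lemma sum_iid_eval:
  assumes "finite E" "finite I" "(\<Sum>v\<in>I. n v) = 1" "e \<in> E"
  shows "(\<Sum>j\<in>E \<rightarrow>\<^sub>E I. iid n E j * h (j e)) = (\<Sum>v\<in>I. n v * h v)"
proof -
  have "(\<Sum>j\<in>E \<rightarrow>\<^sub>E I. iid n E j * h (j e)) = 
    (\<Sum>j\<in>E \<rightarrow>\<^sub>E I. \<Prod>f\<in>E. n (j f) * (if f = e then h (j f) else 1))"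
    using assms by (intro sum.cong) (auto simp: iid_def prod.distrib)
  also have "\<dots> = (\<Prod>f\<in>E. \<Sum>v\<in>I. n v * (if f = e then h v else 1))"
    using prod_sum_PiE[of E "\<lambda>_. I" "\<lambda>f v. n v * (if f = e then h v else 1)"] assms by simp
  also have "\<dots> = (\<Prod>f\<in>E. if f = e then (\<Sum>v\<in>I. n v * h v) else 1)"
    using assms by (intro prod.cong) auto
  finally show ?thesis using assms by simp
qed

text \<open>This is \<open>\<lambda>\<^sub>R\<close> of the outline: the image of the product law
  under \<open>clone E R\<close>.\<close>

definition class_law :: "('v \<Rightarrow> int) \<Rightarrow> nat set \<Rightarrow> 'v set \<Rightarrow> (nat \<times> nat) set \<Rightarrow> (nat \<Rightarrow> 'v) \<Rightarrow> int" where
  "class_law n E I R i = (\<Sum>j\<in>E \<rightarrow>\<^sub>E I. iid n E j * (if clone E R j = i then 1 else 0))"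

lemma sum_class_law:
  assumes "finite E" "finite I" "R \<in> eqrels E"
  shows "(\<Sum>i\<in>E \<rightarrow>\<^sub>E I. class_law n E I R i * f i) = (\<Sum>j\<in>E \<rightarrow>\<^sub>E I. iid n E j * f (clone E R j))"
proof -
  have fin: "finite (E \<rightarrow>\<^sub>E I)" using assms by (simp add: finite_PiE)
  have "(\<Sum>i\<in>E \<rightarrow>\<^sub>E I. class_law n E I R i * f i) =
    (\<Sum>j\<in>E \<rightarrow>\<^sub>E I. \<Sum>i\<in>E \<rightarrow>\<^sub>E I. iid n E j * (if clone E R j = i then f i else 0))"
    unfolding class_law_def sum_distrib_right
    by (subst sum.swap) (intro sum.cong, auto)
  also have "\<dots> = (\<Sum>j\<in>E \<rightarrow>\<^sub>E I. iid n E j * f (clone E R j))"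
    using fin clone_in_PiE[OF assms(1,3)]
    by (intro sum.cong) (auto simp flip: sum_distrib_left)
  finally show ?thesis .
qed

lemma class_law_support:
  assumes "R \<in> eqrels E" "(e, f) \<in> R" "i e \<noteq> i f"
  shows "class_law n E I R i = 0"
proof -
  have "e \<in> E" "f \<in> E" using assms eqrels_subset by auto
  then have "clone E R j \<noteq> i" for j :: "nat \<Rightarrow> 'a"
    using assms class_rep_eq[OF assms(1,2)] by (auto simp: clone_def)
  then show ?thesis by (simp add: class_law_def)
qed

text \<open>The signed law \<open>k\<close> of a pair \<open>(Q, i)\<close> is the Moebius inverse of the class laws. Hence the
  labelling alone looks independent across \<open>E\<close>, while a single label together with \<open>Q\<close> looks
  as if \<open>Q\<close> were always the full relation.\<close>

locale signed_partition =
  fixes E :: "nat set" and I :: "'v set" and n :: "'v \<Rightarrow> int"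
    and k :: "(nat \<times> nat) set \<Rightarrow> (nat \<Rightarrow> 'v) \<Rightarrow> int"
  assumes finE: "finite E" and neE: "E \<noteq> {}" and finI: "finite I"
    and total: "(\<Sum>v\<in>I. n v) = 1"
    and inverse: "\<And>R i. R \<in> eqrels E \<Longrightarrow>
      (\<Sum>Q\<in>{Q\<in>eqrels E. R \<subseteq> Q}. k Q i) = class_law n E I R i"
begin

definition expect :: "((nat \<times> nat) set \<Rightarrow> (nat \<Rightarrow> 'v) \<Rightarrow> int) \<Rightarrow> int" where
  "expect f = (\<Sum>Q\<in>eqrels E. \<Sum>i\<in>E \<rightarrow>\<^sub>E I. k Q i * f Q i)"

text \<open>The relations containing \<open>(e, f)\<close> form an upward closed family, and their
  class laws all vanish at a labelling that separates \<open>e\<close> from \<open>f\<close>.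
  Inversion within this family forces \<open>k\<close> to vanish there too.\<close>

lemma support:
  assumes "Q \<in> eqrels E" "k Q i \<noteq> 0" "(e, f) \<in> Q"
  shows "i e = i f"
proof (rule ccontr)
  assume "i e \<noteq> i f"
  let ?L = "{Q \<in> eqrels E. (e, f) \<in> Q}"
  have "k Q i = 0"
  proof (rule zeta_transform_inj[where L = ?L and le = "(\<subseteq>)" and k' = "\<lambda>_. 0"
        and m = "\<lambda>q. card (E \<times> E - q)"])
    show "finite ?L" using finE by (simp add: finite_eqrels)
    show "Q \<in> ?L" using assms by simp
    fix R assume R: "R \<in> ?L"
    then have "{Q \<in> ?L. R \<subseteq> Q} = {Q \<in> eqrels E. R \<subseteq> Q}" by auto
    then show "(\<Sum>Q\<in>{Q \<in> ?L. R \<subseteq> Q}. k Q i) = (\<Sum>Q\<in>{Q \<in> ?L. R \<subseteq> Q}. 0)"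
      using R inverse[of R i] class_law_support[of R E e f i n I] \<open>i e \<noteq> i f\<close> by simp
  qed (use finE in \<open>auto intro: eqrels_rank_up\<close>)
  then show False using assms by simp
qed

text \<open>Under every class law a single label has law \<open>n\<close>, so the zeta transform of
  the marginals does not depend on \<open>R\<close>. A function concentrated at the top relation
  \<open>E \<times> E\<close> has the same transform, and inversion is unique.\<close>

lemma marginal:
  assumes "Q \<in> eqrels E" "e \<in> E"
  shows "(\<Sum>i\<in>E \<rightarrow>\<^sub>E I. k Q i * h (i e)) = (if Q = E \<times> E then \<Sum>v\<in>I. n v * h v else 0)"
proof (rule zeta_transform_inj[where L = "eqrels E" and le = "(\<subseteq>)" and m = "\<lambda>q. card (E \<times> E - q)"
      and k = "\<lambda>Q. \<Sum>i\<in>E \<rightarrow>\<^sub>E I. k Q i * h (i e)"])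
  fix R assume R: "R \<in> eqrels E"
  let ?U = "{Q \<in> eqrels E. R \<subseteq> Q}"
  have "(\<Sum>Q\<in>?U. \<Sum>i\<in>E \<rightarrow>\<^sub>E I. k Q i * h (i e)) = (\<Sum>i\<in>E \<rightarrow>\<^sub>E I. class_law n E I R i * h (i e))"
    by (subst sum.swap) (simp add: inverse[OF R] flip: sum_distrib_right)
  also have "\<dots> = (\<Sum>j\<in>E \<rightarrow>\<^sub>E I. iid n E j * h (j (class_rep R e)))"
    using assms by (simp add: sum_class_law[OF finE finI R, of n "\<lambda>i. h (i e)"] clone_def)
  also have "\<dots> = (\<Sum>v\<in>I. n v * h v)"
    by (rule sum_iid_eval[OF finE finI total class_rep_in[OF finE R assms(2)]])
  also have "\<dots> = (\<Sum>Q\<in>?U. if Q = E \<times> E then \<Sum>v\<in>I. n v * h v else 0)"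
    using R finE by (simp add: finite_eqrels eqrels_full eqrels_subset)
  finally show "(\<Sum>Q\<in>?U. \<Sum>i\<in>E \<rightarrow>\<^sub>E I. k Q i * h (i e)) =
    (\<Sum>Q\<in>?U. if Q = E \<times> E then \<Sum>v\<in>I. n v * h v else 0)" .
qed (use finE assms in \<open>auto intro: eqrels_rank_up finite_eqrels\<close>)

text \<open>The observed position may vary with \<open>Q\<close>; this matters because the class
  dominating a given simplex point depends on \<open>Q\<close>.\<close>

lemma expect_marginal:
  assumes "\<And>Q. Q \<in> eqrels E \<Longrightarrow> e Q \<in> E"
  shows "expect (\<lambda>Q i. h Q (i (e Q))) = (\<Sum>v\<in>I. n v * h (E \<times> E) v)"
  using finE assms
  by (simp add: expect_def marginal finite_eqrels eqrels_full)

lemma expect_one: "expect (\<lambda>_ _. 1) = 1"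
proof -
  obtain e where "e \<in> E" using neE by blast
  then show ?thesis using expect_marginal[of "\<lambda>_. e" "\<lambda>_ _. 1"] total by simp
qed

text \<open>Indicators of up-sets are integrated without knowing \<open>k\<close>: its sum over the
  relations containing \<open>ext r\<close> is the class law of \<open>ext r\<close>.\<close>

lemma expect_expand:
  assumes "finite T" "\<And>r. r \<in> T \<Longrightarrow> ext r \<in> eqrels E"
    and "\<And>Q i. Q \<in> eqrels E \<Longrightarrow> i \<in> E \<rightarrow>\<^sub>E I \<Longrightarrow> f Q i = (\<Sum>r\<in>T. if ext r \<subseteq> Q then g r i else 0)"
  shows "expect f = (\<Sum>r\<in>T. \<Sum>j\<in>E \<rightarrow>\<^sub>E I. iid n E j * g r (clone E (ext r) j))"
proof -
  have "expect f = (\<Sum>Q\<in>eqrels E. \<Sum>i\<in>E \<rightarrow>\<^sub>E I. \<Sum>r\<in>T. k Q i * (if ext r \<subseteq> Q then g r i else 0))"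
    by (simp add: expect_def assms(3) sum_distrib_left)
  also have "\<dots> = (\<Sum>Q\<in>eqrels E. \<Sum>r\<in>T. \<Sum>i\<in>E \<rightarrow>\<^sub>E I. k Q i * (if ext r \<subseteq> Q then g r i else 0))"
    by (intro sum.cong refl sum.swap)
  also have "\<dots> = (\<Sum>r\<in>T. \<Sum>Q\<in>eqrels E. \<Sum>i\<in>E \<rightarrow>\<^sub>E I. k Q i * (if ext r \<subseteq> Q then g r i else 0))"
    by (rule sum.swap)
  also have "\<dots> = (\<Sum>r\<in>T. \<Sum>i\<in>E \<rightarrow>\<^sub>E I. \<Sum>Q\<in>eqrels E. k Q i * (if ext r \<subseteq> Q then g r i else 0))"
    by (intro sum.cong refl sum.swap)
  also have "\<dots> = (\<Sum>r\<in>T. \<Sum>i\<in>E \<rightarrow>\<^sub>E I. class_law n E I (ext r) i * g r i)"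
    using finE assms(2) inverse
    by (intro sum.cong refl)
       (simp add: sum_distrib_right finite_eqrels if_distrib[of "\<lambda>x. _ * x"] sum.If_cases Int_def
         flip: inverse cong: if_cong)
  also have "\<dots> = (\<Sum>r\<in>T. \<Sum>j\<in>E \<rightarrow>\<^sub>E I. iid n E j * g r (clone E (ext r) j))"
    using assms(2) by (intro sum.cong refl sum_class_law finE finI) auto
  finally show ?thesis .
qed

text \<open>Both factors are expanded into indicators of up-sets. The indicators for
  \<open>r\<close> and \<open>s\<close> multiply to the one for their joint extension, whose class
  law reads independent coordinates on \<open>F\<close> and \<open>G\<close>.\<close>

lemma expect_indep:
  assumes "F \<subseteq> E" "G \<subseteq> E" "F \<inter> G = {}"
  shows "expect (\<lambda>Q i. \<phi> (Q \<inter> F \<times> F) (restrict i F) * \<psi> (Q \<inter> G \<times> G) (restrict i G)) =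
    expect (\<lambda>Q i. \<phi> (Q \<inter> F \<times> F) (restrict i F)) * expect (\<lambda>Q i. \<psi> (Q \<inter> G \<times> G) (restrict i G))"
proof -
  have finF: "finite F" and finG: "finite G" using assms finE by (auto intro: finite_subset)
  \<comment> \<open>Inversion from below, for each fixed labelling: a function of a relation becomes
    a sum over the relations contained in it.\<close>
  have "\<exists>\<phi>'. \<forall>q\<in>eqrels F. (\<Sum>r\<in>{r\<in>eqrels F. r \<subseteq> q}. \<phi>' r) = \<phi> q i" for i
    using zeta_transform_surj[where le = "\<lambda>r q. q \<subseteq> r" and m = card and L = "eqrels F"
        and l = "\<lambda>q. \<phi> q i"] finF by (auto simp: finite_eqrels intro: eqrels_rank_down)
  then obtain \<phi>' where \<phi>': "\<And>q i. q \<in> eqrels F \<Longrightarrow> \<phi> q i = (\<Sum>r\<in>{r\<in>eqrels F. r \<subseteq> q}. \<phi>' i r)"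
    by metis
  have "\<exists>\<psi>'. \<forall>q\<in>eqrels G. (\<Sum>r\<in>{r\<in>eqrels G. r \<subseteq> q}. \<psi>' r) = \<psi> q i" for i
    using zeta_transform_surj[where le = "\<lambda>r q. q \<subseteq> r" and m = card and L = "eqrels G"
        and l = "\<lambda>q. \<psi> q i"] finG by (auto simp: finite_eqrels intro: eqrels_rank_down)
  then obtain \<psi>' where \<psi>': "\<And>q i. q \<in> eqrels G \<Longrightarrow> \<psi> q i = (\<Sum>s\<in>{s\<in>eqrels G. s \<subseteq> q}. \<psi>' i s)"
    by metis
  have sum_prod: "sum f A * sum g B = (\<Sum>(r, s)\<in>A \<times> B. f r * g s)"
    for f g :: "(nat \<times> nat) set \<Rightarrow> int" and A B
    by (simp add: sum_product sum.cartesian_product)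
  have id: "Id_on G' \<in> eqrels G'" for G' :: "nat set"
    by (auto simp: eqrels_def equiv_def refl_on_def sym_def trans_def)
  have id_sub: "Id_on E \<subseteq> Q" if "Q \<in> eqrels E" for Q using that eqrels_refl by auto
  let ?ext1 = "\<lambda>r. r \<union> Id_on E"
  let ?ext = "\<lambda>(r, s). r \<union> s \<union> Id_on E"
  have ext1: "?ext1 r \<in> eqrels E" if "r \<in> eqrels H" "H \<subseteq> E" for r H
    using eqrels_extend[OF that(1) id[of "{}"]] that by auto
  \<comment> \<open>The adjunction between restricting \<open>Q\<close> to \<open>H\<close> and
    extending \<open>r\<close> by singletons; it holds since \<open>Q\<close> contains the
    diagonal.\<close>
  have below: "{r \<in> eqrels H. r \<subseteq> Q \<inter> H \<times> H} = {r \<in> eqrels H. ?ext1 r \<subseteq> Q}"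
    if "Q \<in> eqrels E" for Q H
    using id_sub[OF that] eqrels_subset[of _ H] by blast
  have \<phi>Q: "\<phi> (Q \<inter> F \<times> F) i = (\<Sum>r\<in>eqrels F. if ?ext1 r \<subseteq> Q then \<phi>' i r else 0)"
    if "Q \<in> eqrels E" for Q i
    unfolding \<phi>'[OF eqrels_restrict[OF that assms(1)]] below[OF that]
    using finF by (simp add: sum.If_cases finite_eqrels Int_def)
  have \<psi>Q: "\<psi> (Q \<inter> G \<times> G) i = (\<Sum>s\<in>eqrels G. if ?ext1 s \<subseteq> Q then \<psi>' i s else 0)"
    if "Q \<in> eqrels E" for Q i
    unfolding \<psi>'[OF eqrels_restrict[OF that assms(2)]] below[OF that]
    using finG by (simp add: sum.If_cases finite_eqrels Int_def)
  have cl1: "restrict (clone E (?ext1 r) j) H = clone H r (restrict j H)"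
    if "r \<in> eqrels H" "H \<subseteq> E" for r H and j :: "nat \<Rightarrow> 'v"
    using that eqrels_refl[OF that(1)] finE
    by (intro restrict_clone) (auto intro: finite_subset)
  \<comment> \<open>Adjoining the relation on the other side leaves the classes inside
    \<open>F\<close> and inside \<open>G\<close> unchanged, so the joint extension yields the same
    labels there as the separate ones.\<close>
  have cl2: "restrict (clone E (r \<union> s \<union> Id_on E) j) F = clone F r (restrict j F)"
      "restrict (clone E (r \<union> s \<union> Id_on E) j) G = clone G s (restrict j G)"
    if "r \<in> eqrels F" "s \<in> eqrels G" for r s and j :: "nat \<Rightarrow> 'v"
    using that eqrels_refl[OF that(1)] eqrels_refl[OF that(2)] finF finG assms
      eqrels_subset[OF that(1)] eqrels_subset[OF that(2)]
    by (intro restrict_clone; auto)+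
  have E1: "expect (\<lambda>Q i. \<phi> (Q \<inter> F \<times> F) (restrict i F)) =
    (\<Sum>r\<in>eqrels F. \<Sum>j\<in>E \<rightarrow>\<^sub>E I. iid n E j * \<phi>' (clone F r (restrict j F)) r)"
    using assms finF
    by (subst expect_expand[where T = "eqrels F" and ext = ?ext1 and g = "\<lambda>r i. \<phi>' (restrict i F) r"])
       (auto simp: finite_eqrels ext1 \<phi>Q cl1)
  have E2: "expect (\<lambda>Q i. \<psi> (Q \<inter> G \<times> G) (restrict i G)) =
    (\<Sum>s\<in>eqrels G. \<Sum>j\<in>E \<rightarrow>\<^sub>E I. iid n E j * \<psi>' (clone G s (restrict j G)) s)"
    using assms finG
    by (subst expect_expand[where T = "eqrels G" and ext = ?ext1 and g = "\<lambda>r i. \<psi>' (restrict i G) r"])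
       (auto simp: finite_eqrels ext1 \<psi>Q cl1)
  have "expect (\<lambda>Q i. \<phi> (Q \<inter> F \<times> F) (restrict i F) * \<psi> (Q \<inter> G \<times> G) (restrict i G)) =
    (\<Sum>(r,s)\<in>eqrels F \<times> eqrels G. \<Sum>j\<in>E \<rightarrow>\<^sub>E I. iid n E j *
      (\<phi>' (clone F r (restrict j F)) r * \<psi>' (clone G s (restrict j G)) s))"
  proof (subst expect_expand[where T = "eqrels F \<times> eqrels G" and ext = ?ext
        and g = "\<lambda>(r,s) i. \<phi>' (restrict i F) r * \<psi>' (restrict i G) s"])
    show "\<phi> (Q \<inter> F \<times> F) (restrict i F) * \<psi> (Q \<inter> G \<times> G) (restrict i G) =
      (\<Sum>p\<in>eqrels F \<times> eqrels G. if ?ext p \<subseteq> Q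
        then (\<lambda>(r,s) i. \<phi>' (restrict i F) r * \<psi>' (restrict i G) s) p i else 0)"
      if "Q \<in> eqrels E" for Q i
      unfolding \<phi>Q[OF that] \<psi>Q[OF that] sum_product sum.cartesian_product
      by (intro sum.cong) (auto split: if_splits)
  qed (use assms finF finG in \<open>auto simp: finite_eqrels cl2 intro!: sum.cong eqrels_extend\<close>)
  also have "\<dots> = (\<Sum>(r,s)\<in>eqrels F \<times> eqrels G.
      (\<Sum>j\<in>E \<rightarrow>\<^sub>E I. iid n E j * \<phi>' (clone F r (restrict j F)) r) *
      (\<Sum>j\<in>E \<rightarrow>\<^sub>E I. iid n E j * \<psi>' (clone G s (restrict j G)) s))"
    by (intro sum.cong refl) (clarify, rule iid_indep[OF finE finI total assms])
  also have "\<dots> = expect (\<lambda>Q i. \<phi> (Q \<inter> F \<times> F) (restrict i F)) *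
      expect (\<lambda>Q i. \<psi> (Q \<inter> G \<times> G) (restrict i G))"
    unfolding E1 E2 by (rule sum_prod[symmetric])
  finally show ?thesis .
qed

lemma expect_prod:
  assumes "finite A" "pairwise disjnt A" "\<And>F. F \<in> A \<Longrightarrow> F \<subseteq> E"
  shows "expect (\<lambda>Q i. \<Prod>F\<in>A. \<phi> F (Q \<inter> F \<times> F) (restrict i F)) =
    (\<Prod>F\<in>A. expect (\<lambda>Q i. \<phi> F (Q \<inter> F \<times> F) (restrict i F)))"
  using assms
proof (induction A rule: finite_induct)
  case empty
  then show ?case by (simp add: expect_one)
next
  case (insert F A)
  define U where "U = \<Union>A"
  define \<psi> where "\<psi> q i = (\<Prod>G\<in>A. \<phi> G (q \<inter> G \<times> G) (restrict i G))" for q i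
  have "F \<inter> G = {}" if "G \<in> A" for G
    using insert.prems(1) insert.hyps(2) that by (auto simp: pairwise_insert disjnt_def)
  then have disj: "F \<inter> U = {}" by (auto simp: U_def)
  \<comment> \<open>The product over the remaining faces reads only data on their union, so it can
    be the second factor in the two-set case.\<close>
  have U: "\<psi> (Q \<inter> U \<times> U) (restrict i U) = \<psi> Q i" for Q i
    unfolding \<psi>_def
  proof (intro prod.cong refl)
    fix G assume "G \<in> A"
    then have "Q \<inter> U \<times> U \<inter> G \<times> G = Q \<inter> G \<times> G" "restrict (restrict i U) G = restrict i G"
      by (auto simp: U_def restrict_def fun_eq_iff)
    then show "\<phi> G (Q \<inter> U \<times> U \<inter> G \<times> G) (restrict (restrict i U) G) = \<phi> G (Q \<inter> G \<times> G) (restrict i G)"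
      by simp
  qed
  have "expect (\<lambda>Q i. \<phi> F (Q \<inter> F \<times> F) (restrict i F) * \<psi> (Q \<inter> U \<times> U) (restrict i U)) =
    expect (\<lambda>Q i. \<phi> F (Q \<inter> F \<times> F) (restrict i F)) * expect (\<lambda>Q i. \<psi> (Q \<inter> U \<times> U) (restrict i U))"
    using insert.prems(2) disj by (intro expect_indep) (auto simp: U_def)
  moreover have "expect (\<lambda>Q i. \<psi> Q i) = (\<Prod>G\<in>A. expect (\<lambda>Q i. \<phi> G (Q \<inter> G \<times> G) (restrict i G)))"
    unfolding \<psi>_def using insert by (intro insert.IH) (auto simp: pairwise_insert)
  ultimately show ?case
    unfolding prod.insert[OF insert.hyps] U by (simp only: \<psi>_def)
qed

end

lemma signed_partition_exists:
  assumes "finite E" "E \<noteq> {}" "finite I" "(\<Sum>v\<in>I. n v) = 1"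
  shows "\<exists>k. signed_partition E I n k"
proof -
  have "\<exists>k. \<forall>R\<in>eqrels E. (\<Sum>Q\<in>{Q\<in>eqrels E. R \<subseteq> Q}. k Q) = class_law n E I R i" for i
    using assms(1) by (intro zeta_transform_surj[where m = "\<lambda>q. card (E \<times> E - q)"])
      (auto simp: finite_eqrels intro: eqrels_rank_up)
  then obtain k where "\<And>i R. R \<in> eqrels E \<Longrightarrow>
      (\<Sum>Q\<in>{Q\<in>eqrels E. R \<subseteq> Q}. k i Q) = class_law n E I R i"
    by metis
  then have "signed_partition E I n (\<lambda>Q i. k i Q)"
    using assms by unfold_locales auto
  then show ?thesis by blast
qed

section \<open>Ensembles as linear combinations\<close>

text \<open>\<open>g\<close> may repeat values, and coefficients then add: different labelled
  relations can give the same family of maps.\<close>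

definition lin :: "'d set \<Rightarrow> ('d \<Rightarrow> int) \<Rightarrow> ('d \<Rightarrow> 'w) \<Rightarrow> 'w \<Rightarrow> int" where
  "lin D k g = (\<lambda>w. \<Sum>d\<in>D. k d * gen (g d) w)"

lemma lin_support: "{w. lin D k g w \<noteq> 0} \<subseteq> g ` {d \<in> D. k d \<noteq> 0}"
proof
  fix w assume "w \<in> {w. lin D k g w \<noteq> 0}"
  then obtain d where "d \<in> D" "k d * gen (g d) w \<noteq> 0"
    unfolding lin_def by (metis (mono_tags, lifting) mem_Collect_eq sum.neutral)
  then show "w \<in> g ` {d \<in> D. k d \<noteq> 0}" by (auto simp: gen_def split: if_splits)
qed

lemma lin_in_ens:
  assumes "finite D" "\<And>d. d \<in> D \<Longrightarrow> k d \<noteq> 0 \<Longrightarrow> g d \<in> W"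
  shows "lin D k g \<in> ens W"
  using lin_support[of D k g] assms unfolding ens_def
  by (auto intro: finite_subset[OF lin_support])

lemma push_eq_sum:
  assumes "finite B" "{w. c w \<noteq> 0} \<subseteq> B"
  shows "push f c v = (\<Sum>w\<in>B. c w * gen (f w) v)"
proof -
  have "(\<Sum>w\<in>B. c w * gen (f w) v) = (\<Sum>w\<in>{w. c w \<noteq> 0 \<and> f w = v}. c w * gen (f w) v)"
    using assms by (intro sum.mono_neutral_right) (auto simp: gen_def)
  then show ?thesis by (simp add: push_def gen_def)
qed

lemma push_lin:
  assumes "finite D"
  shows "push f (lin D k g) = lin D k (\<lambda>d. f (g d))"
proof
  fix v
  let ?B = "g ` D"
  have "push f (lin D k g) v = (\<Sum>w\<in>?B. \<Sum>d\<in>D. k d * gen (g d) w * gen (f w) v)"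
    using assms lin_support[of D k g]
    by (subst push_eq_sum[of ?B]) (auto simp: lin_def sum_distrib_right)
  also have "\<dots> = (\<Sum>d\<in>D. \<Sum>w\<in>?B. k d * gen (g d) w * gen (f w) v)" by (rule sum.swap)
  also have "\<dots> = (\<Sum>d\<in>D. k d * gen (f (g d)) v)"
  proof (intro sum.cong refl)
    fix d assume "d \<in> D"
    have "(\<Sum>w\<in>?B. k d * gen (g d) w * gen (f w) v) =
      (\<Sum>w\<in>?B. if w = g d then k d * gen (f w) v else 0)"
      by (intro sum.cong) (auto simp: gen_def)
    then show "(\<Sum>w\<in>?B. k d * gen (g d) w * gen (f w) v) = k d * gen (f (g d)) v"
      using assms \<open>d \<in> D\<close> by simp
  qed
  finally show "push f (lin D k g) v = lin D k (\<lambda>d. f (g d)) v" by (simp add: lin_def)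
qed

lemma restr_lin: "finite D \<Longrightarrow> restr R (lin D k g) = lin D k (\<lambda>d. restrict (g d) R)"
  by (simp add: restr_def push_lin)

lemma ens_eq_lin:
  assumes "A \<in> ens W"
  shows "A = lin {w. A w \<noteq> 0} A (\<lambda>w. w)"
proof
  fix v
  have "finite {w. A w \<noteq> 0}" using assms by (simp add: ens_def)
  then show "A v = lin {w. A w \<noteq> 0} A (\<lambda>w. w) v"
    by (simp add: lin_def gen_def if_distrib[of "(*) _"] cong: if_cong)
qed

text \<open>Indexing the extra generator by \<open>None\<close> makes the difference itself a linear
  combination, so \<open>push_lin\<close> applies to it.\<close>

lemma gen_minus_lin:
  assumes "finite D"
  shows "(\<lambda>w. gen b w - lin D k g w) =
    lin (insert None (Some ` D)) (case_option 1 (\<lambda>d. - k d)) (case_option b g)"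
  using assms by (auto simp: lin_def fun_eq_iff sum.reindex sum_negf)

lemma push_gen_minus_lin:
  assumes "finite D"
  shows "push f (\<lambda>w. gen b w - lin D k g w) = (\<lambda>v. gen (f b) v - lin D k (\<lambda>d. f (g d)) v)"
  using assms by (auto simp: gen_minus_lin push_lin intro!: arg_cong[where f = "lin _ _"] split: option.splits)

section \<open>Maps out of a product with a compact space\<close>

lemma topspace_compact_open [simp]: "topspace (compact_open X x0 Y y0) = based_maps X x0 Y y0"
  by (auto simp: compact_open_def)

lemma openin_compact_open:
  assumes "compactin X K" "openin Y U"
  shows "openin (compact_open X x0 Y y0) {f \<in> based_maps X x0 Y y0. f ` K \<subseteq> U}"
  unfolding compact_open_def using assms by (intro topology_generated_by_Basis) blast

text \<open>Regularity gives a closed, hence compact, neighbourhood \<open>K\<close> of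
  \<open>x\<close> that \<open>w u\<close> sends into \<open>V\<close>. In the compact-open
  topology, sending \<open>K\<close> into \<open>V\<close> is an open condition on the
  parameter.\<close>

lemma continuous_map_uncurry:
  assumes "compact_space X" "Hausdorff_space X" "continuous_map U (compact_open X x0 Y y0) w"
  shows "continuous_map (prod_topology U X) Y (\<lambda>(u, x). w u x)"
proof -
  have w: "w u \<in> based_maps X x0 Y y0" if "u \<in> topspace U" for u
    using assms(3) that by (auto simp: continuous_map_def)
  have "openin (prod_topology U X) {p \<in> topspace (prod_topology U X). (\<lambda>(u, x). w u x) p \<in> V}"
    if V: "openin Y V" for V
  proof (rule openin_subopen[THEN iffD2], intro ballI)
    let ?P = "{p \<in> topspace (prod_topology U X). (\<lambda>(u, x). w u x) p \<in> V}"
    fix p assume "p \<in> ?P"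
    then obtain u x where p: "p = (u, x)" and ux: "u \<in> topspace U" "x \<in> topspace X" "w u x \<in> V"
      by auto
    have "openin X {x \<in> topspace X. w u x \<in> V}"
      using w[OF ux(1)] V by (auto simp: based_maps_def continuous_map_def)
    moreover have "neighbourhood_base_of (closedin X) X"
      using assms by (simp add: neighbourhood_base_of_closedin compact_Hausdorff_imp_regular_space)
    ultimately have "\<exists>N K. openin X N \<and> closedin X K \<and> x \<in> N \<and> N \<subseteq> K \<and>
        K \<subseteq> {x \<in> topspace X. w u x \<in> V}"
      using ux by (simp add: neighbourhood_base_of)
    then obtain N K where NK: "openin X N" "closedin X K" "x \<in> N" "N \<subseteq> K"
        "K \<subseteq> {x \<in> topspace X. w u x \<in> V}"
      by metis
    define G where "G = {v \<in> topspace U. w v \<in> {f \<in> based_maps X x0 Y y0. f ` K \<subseteq> V}}"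
    have "compactin X K" using NK assms by (simp add: closedin_compact_space)
    then have "openin U G"
      unfolding G_def by (intro openin_continuous_map_preimage[OF assms(3)] openin_compact_open V)
    then have "openin (prod_topology U X) (G \<times> N)" using NK by (simp add: openin_prod_Times_iff)
    moreover have "p \<in> G \<times> N" using p NK ux w by (auto simp: G_def)
    moreover have "G \<times> N \<subseteq> ?P"
      using NK by (auto simp: G_def)
    ultimately show "\<exists>T. openin (prod_topology U X) T \<and> p \<in> T \<and> T \<subseteq> ?P"
      by blast
  qed
  moreover have "w u x \<in> topspace Y" if "u \<in> topspace U" "x \<in> topspace X" for u x
    using w[OF that(1)] that(2) by (auto simp: based_maps_def continuous_map_def)
  ultimately show ?thesis by (auto simp: continuous_map_def)
qed

section \<open>The quotient that collapses the basepoint slice\<close>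

lemma openin_wr_top:
  "openin (wr_top U X x0) S \<longleftrightarrow> S \<subseteq> wr_pts U X x0 \<and>
    openin (prod_topology U X) {p \<in> topspace (prod_topology U X). wr_quot x0 p \<in> S}"
proof -
  let ?P = "\<lambda>S. {p \<in> topspace (prod_topology U X). wr_quot x0 p \<in> S}"
  have "istopology (\<lambda>S. S \<subseteq> wr_pts U X x0 \<and> openin (prod_topology U X) (?P S))"
    unfolding istopology_def
  proof (intro conjI allI impI)
    fix S T assume "S \<subseteq> wr_pts U X x0 \<and> openin (prod_topology U X) (?P S)"
      "T \<subseteq> wr_pts U X x0 \<and> openin (prod_topology U X) (?P T)"
    moreover have "?P (S \<inter> T) = ?P S \<inter> ?P T" by auto
    ultimately show "S \<inter> T \<subseteq> wr_pts U X x0" "openin (prod_topology U X) (?P (S \<inter> T))"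
      by auto
  next
    fix \<K> assume K: "\<forall>S\<in>\<K>. S \<subseteq> wr_pts U X x0 \<and> openin (prod_topology U X) (?P S)"
    then show "\<Union>\<K> \<subseteq> wr_pts U X x0" by blast
    have "?P (\<Union>\<K>) = \<Union> (?P ` \<K>)" by auto
    then show "openin (prod_topology U X) (?P (\<Union>\<K>))"
      using K by (simp only:) (intro openin_Union, blast)
  qed
  then show ?thesis by (simp add: wr_top_def topology_inverse')
qed

lemma wr_quot_in: "p \<in> topspace (prod_topology U X) \<Longrightarrow> wr_quot x0 p \<in> wr_pts U X x0"
  by (cases p) (auto simp: wr_quot_def wr_pts_def)

lemma topspace_wr_top: "topspace (wr_top U X x0) = wr_pts U X x0"
proof
  show "topspace (wr_top U X x0) \<subseteq> wr_pts U X x0"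
    by (metis openin_topspace openin_wr_top)
  have "{p \<in> topspace (prod_topology U X). wr_quot x0 p \<in> wr_pts U X x0} = topspace (prod_topology U X)"
    using wr_quot_in[of _ U X x0] by auto
  then have "openin (wr_top U X x0) (wr_pts U X x0)"
    unfolding openin_wr_top by (simp only: openin_topspace subset_refl simp_thms)
  then show "wr_pts U X x0 \<subseteq> topspace (wr_top U X x0)" by (rule openin_subset)
qed

text \<open>Universal property of the quotient: composition with \<open>wr_quot\<close> gives the
  uncurried map, which is \<open>y0\<close> on the collapsed slice because each \<open>w u\<close>
  is based.\<close>

lemma sharp_in_based_maps:
  assumes "compact_space X" "Hausdorff_space X" "continuous_map U (compact_open X x0 Y y0) w"
    and y0: "y0 \<in> topspace Y"
  shows "sharp U X x0 y0 w \<in> based_maps (wr_top U X x0) None Y y0"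
proof -
  let ?s = "sharp U X x0 y0 w"
  have w: "w u x0 = y0" if "u \<in> topspace U" for u
    using assms(3) that by (auto simp: continuous_map_def based_maps_def)
  have unc: "continuous_map (prod_topology U X) Y (\<lambda>(u, x). w u x)"
    using assms by (intro continuous_map_uncurry)
  have quot: "?s (wr_quot x0 p) = (\<lambda>(u, x). w u x) p" if "p \<in> topspace (prod_topology U X)" for p
    using wr_quot_in[OF that, of x0] that w by (cases p) (auto simp: sharp_def wr_quot_def)
  have "?s p \<in> topspace Y" if "p \<in> wr_pts U X x0" for p
    using that y0 unc by (fastforce simp: sharp_def wr_pts_def continuous_map_def Pi_iff)
  moreover have "openin (wr_top U X x0) {p \<in> wr_pts U X x0. ?s p \<in> V}" if "openin Y V" for V
  proof -
    have "{p \<in> topspace (prod_topology U X). wr_quot x0 p \<in> {p \<in> wr_pts U X x0. ?s p \<in> V}} =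
      {p \<in> topspace (prod_topology U X). (\<lambda>(u, x). w u x) p \<in> V}"
      using quot wr_quot_in[of _ U X x0] by auto
    then show ?thesis
      unfolding openin_wr_top using openin_continuous_map_preimage[OF unc that] by auto
  qed
  ultimately have "continuous_map (wr_top U X x0) Y ?s"
    by (auto simp: continuous_map_def topspace_wr_top)
  then show ?thesis
    by (auto simp: based_maps_def topspace_wr_top) (auto simp: sharp_def wr_pts_def)
qed

section \<open>Labelled families of maps over a simplex\<close>

definition weight :: "(nat \<times> nat) set \<Rightarrow> nat \<Rightarrow> (nat \<Rightarrow> real) \<Rightarrow> real" where
  "weight Q e u = sum u (Q `` {e})"

definition heavy_elt :: "nat set \<Rightarrow> (nat \<times> nat) set \<Rightarrow> (nat \<Rightarrow> real) \<Rightarrow> nat" where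
  "heavy_elt E Q u = (SOME e. e \<in> E \<and> weight Q e u > 1/2)"

lemma heavy_elt: "\<exists>e\<in>E. weight Q e u > 1/2 \<Longrightarrow> heavy_elt E Q u \<in> E \<and> weight Q (heavy_elt E Q u) u > 1/2"
  unfolding heavy_elt_def by (rule someI_ex) blast

text \<open>Two distinct classes cannot both carry more than half of the total weight, so the value at
  \<open>u\<close> involves the label of at most one class. If \<open>g v 0 = a\<close>, the path is still at \<open>a\<close> as long as
  the weight is at most 2/3; the overlap of the two regimes makes the family continuous.\<close>

definition star_map :: "nat set \<Rightarrow> 'v \<Rightarrow> ('v \<Rightarrow> real \<Rightarrow> 'v) \<Rightarrow> (nat \<times> nat) set \<Rightarrow> (nat \<Rightarrow> 'v) \<Rightarrow>
    (nat \<Rightarrow> real) \<Rightarrow> 'v" where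
  "star_map E a g Q i u =
    (if \<exists>e\<in>E. weight Q e u > 1/2
     then g (i (heavy_elt E Q u)) (max 0 (3 * weight Q (heavy_elt E Q u) u - 2))
     else a)"

lemma simplex_of_mono:
  assumes "finite E" "F \<subseteq> E"
  shows "simplex_of F \<subseteq> simplex_of E"
proof
  fix t assume t: "t \<in> simplex_of F"
  then have "sum t F = sum t E"
    using assms by (intro sum.mono_neutral_left) (auto simp: simplex_of_def)
  moreover have "0 \<le> t e" for e using t by (cases "e \<in> F") (auto simp: simplex_of_def)
  ultimately show "t \<in> simplex_of E" using t assms by (auto simp: simplex_of_def)
qed

lemma sum_simplex_le_1:
  assumes "finite E" "u \<in> simplex_of E" "B \<subseteq> E"
  shows "sum u B \<le> 1"
proof -
  have "sum u B \<le> sum u E" using assms by (intro sum_mono2) (auto simp: simplex_of_def)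
  then show ?thesis using assms by (simp add: simplex_of_def)
qed

lemma class_subset: "Q \<in> eqrels E \<Longrightarrow> Q `` {e} \<subseteq> E"
  using eqrels_subset[of Q E] by blast

lemma weight_le_1: "finite E \<Longrightarrow> Q \<in> eqrels E \<Longrightarrow> u \<in> simplex_of E \<Longrightarrow> weight Q e u \<le> 1"
  unfolding weight_def by (rule sum_simplex_le_1[OF _ _ class_subset])

lemma heavy_classes_equal:
  assumes "finite E" "Q \<in> eqrels E" "u \<in> simplex_of E"
    and "weight Q e u > 1/2" "weight Q f u > 1/2"
  shows "(e, f) \<in> Q"
proof (rule ccontr)
  assume "(e, f) \<notin> Q"
  then have "Q `` {e} \<inter> Q `` {f} = {}"
    using eqrels_sym[OF assms(2)] eqrels_trans[OF assms(2)] by blast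
  moreover have "finite (Q `` {e})" "finite (Q `` {f})"
    using class_subset[OF assms(2)] assms(1) by (auto intro: finite_subset)
  ultimately have "weight Q e u + weight Q f u = sum u (Q `` {e} \<union> Q `` {f})"
    by (simp add: weight_def sum.union_disjoint)
  also have "\<dots> \<le> 1"
    using class_subset[OF assms(2)] by (intro sum_simplex_le_1[OF assms(1,3)]) auto
  finally show False using assms by simp
qed

lemma weight_eq:
  assumes "Q \<in> eqrels E" "(e, f) \<in> Q"
  shows "weight Q e u = weight Q f u"
proof -
  have "Q `` {e} = Q `` {f}"
    using assms eqrels_sym[OF assms(1)] eqrels_trans[OF assms(1)] by blast
  then show ?thesis by (simp add: weight_def)
qed

text \<open>The choice in \<open>heavy_elt\<close> is immaterial: all elements of weight above 1/2
  lie in one class, on which \<open>i\<close> and the weight are constant.\<close>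

lemma star_map_heavy:
  assumes "finite E" "Q \<in> eqrels E" "u \<in> simplex_of E"
    and i: "\<And>e f. (e, f) \<in> Q \<Longrightarrow> i e = i f"
    and e: "e \<in> E" "weight Q e u > 1/2"
  shows "star_map E a g Q i u = g (i e) (max 0 (3 * weight Q e u - 2))"
proof -
  define f where "f = heavy_elt E Q u"
  have "f \<in> E \<and> weight Q f u > 1/2" unfolding f_def by (rule heavy_elt) (use e in blast)
  then have "(f, e) \<in> Q" using heavy_classes_equal[OF assms(1-3)] e by blast
  then have "i f = i e" "weight Q f u = weight Q e u" using i weight_eq[OF assms(2)] by blast+
  then show ?thesis using e by (auto simp: star_map_def simp flip: f_def)
qed

lemma star_map_light:
  assumes "\<And>e. e \<in> E \<Longrightarrow> weight Q e u \<le> 2/3" "\<And>e. e \<in> E \<Longrightarrow> g (i e) 0 = a"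
  shows "star_map E a g Q i u = a"
proof (cases "\<exists>e\<in>E. weight Q e u > 1/2")
  case True
  define f where "f = heavy_elt E Q u"
  have f: "f \<in> E \<and> weight Q f u > 1/2" unfolding f_def by (rule heavy_elt[OF True])
  then have "max 0 (3 * weight Q f u - 2) = 0" using assms(1)[of f] by simp
  then show ?thesis using True f assms(2)[of f] by (simp add: star_map_def flip: f_def)
qed (simp add: star_map_def)

lemma weight_face:
  assumes "finite E" "Q \<in> eqrels E" "F \<subseteq> E" "u \<in> simplex_of F" "e \<in> F"
  shows "weight (Q \<inter> F \<times> F) e u = weight Q e u"
  unfolding weight_def
  using assms class_subset[OF assms(2), of e]
  by (intro sum.mono_neutral_left) (auto simp: simplex_of_def intro: finite_subset)

text \<open>On the face of \<open>F\<close> the coordinates outside \<open>F\<close> vanish, so a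
  heavy class must meet \<open>F\<close> and keeps its weight when cut down to
  \<open>F\<close>.\<close>

lemma star_map_face:
  assumes "finite E" "Q \<in> eqrels E" "F \<subseteq> E" "u \<in> simplex_of F"
    and i: "\<And>e f. (e, f) \<in> Q \<Longrightarrow> i e = i f"
  shows "star_map E a g Q i u = star_map F a g (Q \<inter> F \<times> F) (restrict i F) u"
proof (cases "\<exists>e\<in>E. weight Q e u > 1/2")
  case True
  then obtain e where e: "e \<in> E" "weight Q e u > 1/2" by blast
  have uE: "u \<in> simplex_of E" using simplex_of_mono assms by blast
  have "\<exists>f\<in>F. (e, f) \<in> Q"
  proof (rule ccontr)
    assume "\<not> ?thesis"
    then have "weight Q e u = 0"
      using assms(4) unfolding weight_def by (intro sum.neutral) (auto simp: simplex_of_def)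
    then show False using e by simp
  qed
  then obtain f where f: "f \<in> F" "(e, f) \<in> Q" by blast
  then have wf: "weight Q f u > 1/2" using e weight_eq[OF assms(2)] by metis
  have "star_map E a g Q i u = g (i f) (max 0 (3 * weight Q f u - 2))"
    using f assms wf uE by (intro star_map_heavy[OF assms(1,2)]) auto
  also have "\<dots> = star_map F a g (Q \<inter> F \<times> F) (restrict i F) u"
    using f assms wf weight_face[OF assms(1-4) f(1)] eqrels_restrict[OF assms(2,3)]
    by (subst star_map_heavy[where e = f]) (auto intro: finite_subset)
  finally show ?thesis .
next
  case False
  then have "\<not> (\<exists>e\<in>F. weight (Q \<inter> F \<times> F) e u > 1/2)"
    using weight_face[OF assms(1-4)] assms(3) by (metis subsetD)
  then show ?thesis using False by (simp add: star_map_def)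
qed

lemma continuous_weight: "continuous_on S (weight Q e)"
  unfolding weight_def
  by (intro continuous_on_sum continuous_on_subset[OF continuous_on_product_coordinates] subset_UNIV)

lemma continuous_star_map:
  assumes "finite E" "Q \<in> eqrels E" and i: "\<And>e f. (e, f) \<in> Q \<Longrightarrow> i e = i f"
    and g: "\<And>e. e \<in> E \<Longrightarrow> pathin Z (g (i e))" "\<And>e. e \<in> E \<Longrightarrow> g (i e) 0 = a"
    and a: "a \<in> topspace Z"
  shows "continuous_map (simplex_top E) Z (star_map E a g Q i)"
proof -
  have ts: "topspace (simplex_top E) = simplex_of E" by (simp add: simplex_top_def)
  \<comment> \<open>An open cover for pasting: on \<open>None\<close> the family rests at
    \<open>a\<close>, on \<open>Some e\<close> the class of \<open>e\<close> dominates. Both local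
    formulas compute \<open>star_map\<close>, so they agree on overlaps.\<close>
  define T where "T j = (case j of None \<Rightarrow> {u \<in> simplex_of E. \<forall>e\<in>E. weight Q e u < 2/3}
    | Some e \<Rightarrow> {u \<in> simplex_of E. 1/2 < weight Q e u})" for j
  define f where "f j u = (case j of None \<Rightarrow> a | Some e \<Rightarrow> g (i e) (max 0 (3 * weight Q e u - 2)))"
    for j u
  have cw: "continuous_map (simplex_top E) euclideanreal (weight Q e)" for e
    by (simp add: simplex_top_def continuous_weight)
  have eq: "f j u = star_map E a g Q i u" if "j \<in> insert None (Some ` E)" "u \<in> T j" for j u
  proof (cases j)
    case None
    have "weight Q e u \<le> 2/3" if "e \<in> E" for e
      using \<open>u \<in> T j\<close> None that by (force simp: T_def)
    then show ?thesis using None g(2) by (simp add: f_def star_map_light)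
  next
    case (Some e)
    then have "star_map E a g Q i u = g (i e) (max 0 (3 * weight Q e u - 2))"
      using that by (intro star_map_heavy[OF assms(1,2) _ i]) (auto simp: T_def)
    then show ?thesis using Some by (simp add: f_def)
  qed
  show ?thesis
  proof (rule pasting_lemma[where I = "insert None (Some ` E)" and T = T and f = f])
    fix j assume j: "j \<in> insert None (Some ` E)"
    have op: "openin (simplex_top E) {u \<in> simplex_of E. weight Q e u \<in> B}" if "open B" for e B
      using openin_continuous_map_preimage[OF cw, of B e] that by (simp add: ts)
    show "openin (simplex_top E) (T j)"
    proof (cases j)
      case None
      have "T j = simplex_of E \<inter> \<Inter> ((\<lambda>e. {u \<in> simplex_of E. weight Q e u \<in> {..<2/3}}) ` E)"
        using None by (auto simp: T_def)
      then show ?thesis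
        using op[of "{..<2/3}"] assms(1) openin_topspace[of "simplex_top E", unfolded ts]
        by (cases "E = {}") (auto intro!: openin_Int openin_INT)
    next
      case (Some e)
      then show ?thesis using op[of "{1/2<..}" e] by (simp add: T_def)
    qed
    show "continuous_map (subtopology (simplex_top E) (T j)) Z (f j)"
    proof (cases j)
      case None
      then have "f j = (\<lambda>_. a)" by (simp add: f_def fun_eq_iff)
      then show ?thesis using a by simp
    next
      case (Some e)
      have "continuous_map (simplex_top E) (top_of_set {0..1}) (\<lambda>u. max 0 (3 * weight Q e u - 2))"
        using cw[of e] weight_le_1[OF assms(1,2)]
        by (auto simp: continuous_map_in_subtopology ts intro!: continuous_intros)
      then have "continuous_map (simplex_top E) Z (g (i e) \<circ> (\<lambda>u. max 0 (3 * weight Q e u - 2)))"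
        using g(1)[of e] j Some by (auto simp: pathin_def intro: continuous_map_compose)
      moreover have "f j = g (i e) \<circ> (\<lambda>u. max 0 (3 * weight Q e u - 2))"
        using Some by (simp add: f_def fun_eq_iff)
      ultimately show ?thesis by (simp add: continuous_map_from_subtopology)
    qed
  next
    fix j j' u
    assume "j \<in> insert None (Some ` E)" "j' \<in> insert None (Some ` E)"
      "u \<in> topspace (simplex_top E) \<inter> T j \<inter> T j'"
    then show "f j u = f j' u" using eq by simp
  next
    fix u assume "u \<in> topspace (simplex_top E)"
    then have "\<exists>j\<in>insert None (Some ` E). u \<in> T j"
      by (force simp: T_def ts not_less)
    then show "\<exists>j. j \<in> insert None (Some ` E) \<and> u \<in> T j \<and> star_map E a g Q i u = f j u"
      using eq by metis
  qed
qed

section \<open>The ensemble of star families: fissility and pointwise behaviour\<close>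

context signed_partition
begin

text \<open>Agreement is asked only where \<open>k\<close> is nonzero, so by \<open>support\<close>
  the labels may be taken constant on classes.\<close>

lemma expect_cong:
  assumes "\<And>Q i. Q \<in> eqrels E \<Longrightarrow> i \<in> E \<rightarrow>\<^sub>E I \<Longrightarrow> k Q i \<noteq> 0 \<Longrightarrow> f Q i = f' Q i"
  shows "expect f = expect f'"
  unfolding expect_def using assms by (intro sum.cong refl) (metis mult_eq_0_iff)

lemma finite_index: "finite (eqrels E \<times> (E \<rightarrow>\<^sub>E I))"
  using finE finI by (simp add: finite_eqrels finite_PiE)

definition star_ens :: "'v \<Rightarrow> ('v \<Rightarrow> real \<Rightarrow> 'v) \<Rightarrow> ((nat \<Rightarrow> real) \<Rightarrow> 'v) \<Rightarrow> int" where
  "star_ens a g = lin (eqrels E \<times> (E \<rightarrow>\<^sub>E I)) (\<lambda>(Q, i). k Q i)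
    (\<lambda>(Q, i). restrict (star_map E a g Q i) (simplex_of E))"

lemma restr_star_ens:
  assumes "R \<subseteq> simplex_of E"
  shows "restr R (star_ens a g) w = expect (\<lambda>Q i. gen (restrict (star_map E a g Q i) R) w)"
proof -
  have R: "simplex_of E \<inter> R = R" using assms by blast
  show ?thesis
    unfolding star_ens_def restr_lin[OF finite_index]
    by (simp add: lin_def expect_def sum.cartesian_product case_prod_beta R)
qed

text \<open>A coefficient of the restricted ensemble is the expectation of an indicator. This
  indicator splits into factors that each read the relation and labels on one face, and
  \<open>expect_prod\<close> yields the product in \<open>combine\<close>.\<close>

lemma fissile_star_ens: "fissile E (star_ens a g)"
  unfolding fissile_def
proof (intro allI impI ext)
  fix A w assume A: "layout E A"
  have sub: "F \<subseteq> E" if "F \<in> A" for F using A that by (simp add: layout_def)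
  have finA: "finite A" by (rule finite_subset[of _ "Pow E"]) (use sub finE in auto)
  have simp_sub: "simplex_of F \<subseteq> simplex_of E" if "F \<in> A" for F
    by (rule simplex_of_mono[OF finE sub[OF that]])
  then have "layout_set A \<subseteq> simplex_of E" by (auto simp: layout_set_def)
  then have lhs: "restr (layout_set A) (star_ens a g) w =
      expect (\<lambda>Q i. gen (restrict (star_map E a g Q i) (layout_set A)) w)"
    by (rule restr_star_ens)
  show "restr (layout_set A) (star_ens a g) w =
    combine A (\<lambda>F. restr (simplex_of F) (star_ens a g)) w"
  proof (cases "w \<in> extensional (layout_set A)")
    case False
    then have "w \<noteq> restrict (star_map E a g Q i) (layout_set A)" for Q i by auto
    then show ?thesis using False by (simp add: lhs combine_def expect_def gen_def)
  next
    case True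
    define \<phi> where "\<phi> F q j = gen (restrict (star_map F a g q j) (simplex_of F))
      (restrict w (simplex_of F))" for F q j
    have face: "gen (restrict (star_map E a g Q i) (simplex_of F)) (restrict w (simplex_of F)) =
        \<phi> F (Q \<inter> F \<times> F) (restrict i F)"
      if "Q \<in> eqrels E" "k Q i \<noteq> 0" "F \<in> A" for Q i F
    proof -
      have "restrict (star_map E a g Q i) (simplex_of F) =
        restrict (star_map F a g (Q \<inter> F \<times> F) (restrict i F)) (simplex_of F)"
        by (intro restrict_ext star_map_face[OF finE that(1) sub[OF that(3)]])
           (auto intro: support[OF that(1,2)])
      then show ?thesis by (simp only: \<phi>_def)
    qed
    \<comment> \<open>Maps on the union agree exactly when they agree on every face.\<close>
    have split: "gen (restrict h (layout_set A)) w =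
      (\<Prod>F\<in>A. gen (restrict h (simplex_of F)) (restrict w (simplex_of F)))" for h
    proof (cases "w = restrict h (layout_set A)")
      case True
      have "restrict w (simplex_of F) = restrict h (simplex_of F)" if "F \<in> A" for F
        unfolding True using that by (intro restrict_ext) (auto simp: layout_set_def)
      then show ?thesis using True by (simp add: gen_def)
    next
      case False
      then obtain u where "u \<in> layout_set A" "w u \<noteq> h u"
        using \<open>w \<in> extensional (layout_set A)\<close> by (metis extensionalityI restrict_apply' restrict_extensional)
      then obtain F where F: "F \<in> A" "u \<in> simplex_of F" by (auto simp: layout_set_def)
      then have "restrict w (simplex_of F) \<noteq> restrict h (simplex_of F)"
        using \<open>w u \<noteq> h u\<close> by (metis restrict_apply')
      then have "gen (restrict h (simplex_of F)) (restrict w (simplex_of F)) = 0"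
        by (simp only: gen_def if_False)
      then have "(\<Prod>F\<in>A. gen (restrict h (simplex_of F)) (restrict w (simplex_of F))) = 0"
        using F(1) by (intro prod_zero[OF finA] bexI)
      then show ?thesis using False by (simp only: gen_def if_False)
    qed
    have "restr (layout_set A) (star_ens a g) w =
        expect (\<lambda>Q i. \<Prod>F\<in>A. \<phi> F (Q \<inter> F \<times> F) (restrict i F))"
      unfolding lhs split using face by (intro expect_cong prod.cong refl) blast
    also have "\<dots> = (\<Prod>F\<in>A. expect (\<lambda>Q i. \<phi> F (Q \<inter> F \<times> F) (restrict i F)))"
      using A sub finA by (intro expect_prod) (auto simp: layout_def)
    also have "\<dots> = (\<Prod>F\<in>A. restr (simplex_of F) (star_ens a g) (restrict w (simplex_of F)))"
      using face by (intro prod.cong refl)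
        (simp only: restr_star_ens[OF simp_sub], rule expect_cong, metis)
    finally show ?thesis using True by (simp add: combine_def)
  qed
qed

text \<open>At a fixed \<open>u\<close> only one label is read, so only the full relation survives.
  Its single class has weight 1, where the path has arrived at \<open>v\<close>. \<open>H\<close>
  allows recording only part of the value.\<close>

lemma star_ens_marginal:
  assumes u: "u \<in> simplex_of E" and g: "\<And>v. v \<in> I \<Longrightarrow> g v 1 = v"
  shows "expect (\<lambda>Q i. gen (H (star_map E a g Q i u)) y) = (\<Sum>v\<in>I. n v * gen (H v) y)"
proof -
  obtain e0 where e0: "e0 \<in> E" using neE by blast
  let ?heavy = "\<lambda>Q. \<exists>e\<in>E. weight Q e u > 1/2"
  \<comment> \<open>The position of the label that is read. The fallback \<open>e0\<close> is
    harmless, since without a heavy class the value is \<open>a\<close> for every label.\<close>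
  define e where "e Q = (if ?heavy Q then heavy_elt E Q u else e0)" for Q
  define h where "h Q v = gen (H (if ?heavy Q then g v (max 0 (3 * weight Q (e Q) u - 2)) else a)) y"
    for Q v
  have e: "e Q \<in> E" for Q
    using heavy_elt[of E Q u] e0 by (cases "?heavy Q") (auto simp: e_def)
  have top: "weight (E \<times> E) f u = 1" if "f \<in> E" for f
    using u that by (simp add: weight_def simplex_of_def Image_singleton)
  have "expect (\<lambda>Q i. gen (H (star_map E a g Q i u)) y) = expect (\<lambda>Q i. h Q (i (e Q)))"
    by (intro expect_cong) (simp add: star_map_def h_def e_def)
  also have "\<dots> = (\<Sum>v\<in>I. n v * h (E \<times> E) v)" by (rule expect_marginal) (rule e)
  also have "\<dots> = (\<Sum>v\<in>I. n v * gen (H v) y)"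
  proof (intro sum.cong refl)
    fix v assume "v \<in> I"
    moreover have "?heavy (E \<times> E)" using e0 top[OF e0] by (intro bexI[of _ e0]) auto
    ultimately show "n v * h (E \<times> E) v = n v * gen (H v) y"
      using g top[OF e] by (simp add: h_def)
  qed
  finally show ?thesis .
qed

end

section \<open>Strong 1-similarity from the star ensemble\<close>

theorem theorem14p2:
  fixes X :: "'a topology" and x0 :: 'a and Y :: "'b topology" and y0 :: 'b
    and a b :: "'a \<Rightarrow> 'b"
  assumes "cellular X x0" and "cellular Y y0" and "compact_space X"
    and "a \<in> based_maps X x0 Y y0" and "b \<in> based_maps X x0 Y y0"
    and "similar X x0 Y y0 1 a b"
  shows "strongly_similar X x0 Y y0 1 a b"
  unfolding strongly_similar_def
proof (intro allI impI)
  fix E :: "nat set" assume E: "finite E \<and> E \<noteq> {}"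
  let ?Z = "compact_open X x0 Y y0" and ?\<Delta> = "simplex_top E"
  have haus: "Hausdorff_space X" and x0: "x0 \<in> topspace X"
    using assms(1) by (auto simp: cellular_def cw_structure_def)
  have y0: "y0 \<in> topspace Y"
    using assms(2) by (auto simp: cellular_def cw_structure_def)
  obtain A where A: "A \<in> ens (map_pc X x0 Y y0 a)"
    and Ab: "(\<lambda>w. gen b w - A w) \<in> ens_filt X x0 Y y0 2"
    using assms(6) by (auto simp: similar_def numeral_2_eq_2)
  define I where "I = {v. A v \<noteq> 0}"
  have finI: "finite I" and I: "I \<subseteq> map_pc X x0 Y y0 a" using A by (auto simp: I_def ens_def)
  have pc: "map_pc X x0 Y y0 a \<subseteq> based_maps X x0 Y y0"
    using path_component_of_subset_topspace[of ?Z a] by (simp add: map_pc_def)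
  have A_lin: "A = lin I A (\<lambda>v. v)" unfolding I_def by (rule ens_eq_lin[OF A])
  \<comment> \<open>A set of at most two points containing \<open>x0\<close> has at most one free
    point, so 1-similarity compares \<open>b\<close> with \<open>A\<close> at individual points of
    \<open>X\<close>.\<close>
  have point: "gen (restrict b R) y = (\<Sum>v\<in>I. A v * gen (restrict v R) y)"
    if "R \<subseteq> {x0, x}" "x0 \<in> R" "x \<in> topspace X" for R x y
  proof -
    have "card R \<le> 2" using card_mono[OF _ that(1)] by (simp add: card_insert_if split: if_splits)
    then have "restr R (\<lambda>w. gen b w - A w) = (\<lambda>_. 0)"
      using Ab that x0 finite_subset[OF that(1)] by (auto simp: ens_filt_def)
    then have "gen (restrict b R) y - lin I A (\<lambda>v. restrict v R) y = 0"
      using push_gen_minus_lin[OF finI, of "\<lambda>f. restrict f R" b A "\<lambda>v. v"] A_lin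
      unfolding restr_def by metis
    then show ?thesis by (simp add: lin_def)
  qed
  have based: "v x0 = y0" if "v \<in> I" for v using that I pc by (auto simp: based_maps_def)
  \<comment> \<open>All based maps agree at the basepoint, so the comparison there reads off the
    total coefficient of \<open>A\<close>.\<close>
  have total: "(\<Sum>v\<in>I. A v) = 1"
  proof -
    have "restrict v {x0} = restrict b {x0}" if "v \<in> I" for v
      using based[OF that] assms(5) by (intro restrict_ext) (auto simp: based_maps_def)
    then have "(\<Sum>v\<in>I. A v * gen (restrict v {x0}) (restrict b {x0})) = (\<Sum>v\<in>I. A v)"
      by (intro sum.cong refl) (simp only: gen_def simp_thms if_True mult_1_right)
    then show ?thesis using point[of "{x0}" x0 "restrict b {x0}"] x0 by (simp add: gen_def)
  qed
  obtain k where "signed_partition E I A k"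
    using signed_partition_exists[of E I A] E finI total by blast
  then interpret signed_partition E I A k .
  have "\<exists>p. pathin ?Z p \<and> p 0 = a \<and> p 1 = v" if "v \<in> I" for v
    using that I by (auto simp: map_pc_def path_component_of_def)
  then obtain g where g: "\<And>v. v \<in> I \<Longrightarrow> pathin ?Z (g v) \<and> g v 0 = a \<and> g v 1 = v" by metis
  have pathin_pc: "pathin (subtopology ?Z (map_pc X x0 Y y0 a)) (g v)" if "v \<in> I" for v
  proof -
    have "g v ` {0..1} \<subseteq> map_pc X x0 Y y0 a"
      unfolding map_pc_def using g[OF that]
      by (intro path_component_of_maximal path_connectedin_path_image) (auto intro!: image_eqI[of _ _ 0])
    then show ?thesis using g[OF that] by (auto simp: pathin_def continuous_map_in_subtopology)
  qed
  have a_pc: "a \<in> topspace (subtopology ?Z (map_pc X x0 Y y0 a))"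
    using assms(4) by (simp add: map_pc_def path_component_of_refl)
  let ?S = "star_ens a g"
  \<comment> \<open>For a nonzero coefficient, \<open>support\<close> makes the labels constant on
    classes, as continuity requires.\<close>
  have cont: "continuous_map ?\<Delta> (subtopology ?Z (map_pc X x0 Y y0 a)) (star_map E a g Q i)"
    if "Q \<in> eqrels E" "i \<in> E \<rightarrow>\<^sub>E I" "k Q i \<noteq> 0" for Q i
    using that g pathin_pc a_pc finE support[OF that(1,3)] PiE_mem[OF that(2)]
    by (intro continuous_star_map) auto
  have cont_restrict: "restrict (star_map E a g Q i) (simplex_of E) \<in>
      unbased_maps ?\<Delta> (subtopology ?Z (map_pc X x0 Y y0 a))"
    if "Q \<in> eqrels E" "i \<in> E \<rightarrow>\<^sub>E I" "k Q i \<noteq> 0" for Q i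
    using cont[OF that] continuous_map_eq[OF cont[OF that], of "restrict (star_map E a g Q i) (simplex_of E)"]
    by (auto simp: unbased_maps_def simplex_top_def)
  have S_ens: "?S \<in> ens (unbased_maps ?\<Delta> (subtopology ?Z (map_pc X x0 Y y0 a)))"
    unfolding star_ens_def using cont_restrict by (intro lin_in_ens finite_index) auto
  let ?D = "eqrels E \<times> (E \<rightarrow>\<^sub>E I)"
  let ?W = "\<lambda>(Q, i). restrict (star_map E a g Q i) (simplex_of E)"
  let ?V = "\<lambda>w. gen (const_map ?\<Delta> b) w - ?S w"
  let ?sh = "sharp ?\<Delta> X x0 y0"
  have V_lin: "?V = lin (insert None (Some ` ?D)) (case_option 1 (\<lambda>d. - (case d of (Q, i) \<Rightarrow> k Q i)))
      (case_option (const_map ?\<Delta> b) ?W)"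
    unfolding star_ens_def by (rule gen_minus_lin[OF finite_index])
  have const: "const_map ?\<Delta> b \<in> unbased_maps ?\<Delta> ?Z"
    using assms(5) continuous_map_eq[of ?\<Delta> ?Z "\<lambda>_. b" "const_map ?\<Delta> b"]
    by (simp add: unbased_maps_def const_map_def)
  have W: "?W d \<in> unbased_maps ?\<Delta> ?Z" if "d \<in> ?D" "(case d of (Q, i) \<Rightarrow> k Q i) \<noteq> 0" for d
    using that cont_restrict by (auto simp: unbased_maps_def continuous_map_in_subtopology)
  have V_ens: "?V \<in> ens (unbased_maps ?\<Delta> ?Z)"
    unfolding V_lin using const W finite_index by (intro lin_in_ens) auto
  have sh: "?sh w \<in> based_maps (wr_top ?\<Delta> X x0) None Y y0" if "w \<in> unbased_maps ?\<Delta> ?Z" for w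
    using that assms(3) haus y0 by (intro sharp_in_based_maps) (auto simp: unbased_maps_def)
  have "push ?sh ?V \<in> ens (based_maps (wr_top ?\<Delta> X x0) None Y y0)"
    unfolding V_lin push_lin[OF finite.insertI[OF finite_imageI[OF finite_index]]]
    using const W finite_index sh by (intro lin_in_ens) auto
  moreover have "restr R (push ?sh ?V) = (\<lambda>_. 0)"
    if R: "finite R" "R \<subseteq> wr_pts ?\<Delta> X x0" "None \<in> R" "card R \<le> 2" for R
  proof
    fix y
    \<comment> \<open>A vertex of the simplex, to serve as parameter when \<open>R\<close> contains
      only \<open>None\<close>.\<close>
    obtain u0 where u0: "u0 \<in> simplex_of E"
    proof -
      obtain e where "e \<in> E" using E by blast
      then have "(\<lambda>f. if f = e then 1 else 0) \<in> simplex_of E" using E by (auto simp: simplex_of_def)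
      then show ?thesis using that by blast
    qed
    have "card (R - {None}) \<le> 1" using R by (simp add: card_Diff_singleton_if)
    then have "R - {None} = {} \<or> (\<exists>q. R - {None} = {q})"
      using R(1) by (metis One_nat_def card_1_singletonE card_0_eq finite_Diff le_Suc_eq le_zero_eq)
    \<comment> \<open>Besides \<open>None\<close> there is at most one point in \<open>R\<close>, so
      a single parameter \<open>u\<close> is involved. This is where order 1 enters.\<close>
    then obtain u x where ux: "u \<in> simplex_of E" "x \<in> topspace X" "R \<subseteq> {None, Some (u, x)}"
    proof
      assume "R - {None} = {}"
      then show ?thesis using that[of u0 x0] u0 x0 by blast
    next
      assume "\<exists>q. R - {None} = {q}"
      then obtain q where q: "R - {None} = {q}" by blast
      then have "q \<in> R - {None}" by (simp only: singleton_iff)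
      then have "q \<in> R" "q \<noteq> None" by (simp_all only: Diff_iff singleton_iff simp_thms)
      then have "q \<in> wr_pts ?\<Delta> X x0" using R(2) by (simp add: subsetD)
      with \<open>q \<noteq> None\<close> obtain u x where "q = Some (u, x)" "u \<in> simplex_of E" "x \<in> topspace X"
        by (auto simp: wr_pts_def simplex_top_def)
      then show ?thesis using that[of u x] q R(3) by auto
    qed
    \<comment> \<open>Of a family, \<open>R\<close> sees at most the value at \<open>x\<close> of
      its member at \<open>u\<close>; \<open>H\<close> records it.\<close>
    define H where "H f = (\<lambda>p\<in>R. case p of None \<Rightarrow> y0 | Some _ \<Rightarrow> f x)" for f :: "'a \<Rightarrow> 'b"
    have sharp_R: "restrict (?sh w) R = H (w u)" for w
      unfolding H_def using R(2) ux(3)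
      by (intro restrict_ext) (auto simp: sharp_def split: option.splits)
    have "restr R (push ?sh ?V) y = gen (restrict (?sh (const_map ?\<Delta> b)) R) y -
        lin ?D (\<lambda>(Q, i). k Q i) (\<lambda>d. restrict (?sh (?W d)) R) y"
      unfolding restr_def star_ens_def push_gen_minus_lin[OF finite_index] ..
    also have "\<dots> = gen (H b) y - expect (\<lambda>Q i. gen (H (star_map E a g Q i u)) y)"
      unfolding sharp_R using ux(1)
      by (simp add: const_map_def simplex_top_def case_prod_beta lin_def expect_def sum.cartesian_product)
    also have "expect (\<lambda>Q i. gen (H (star_map E a g Q i u)) y) = (\<Sum>v\<in>I. A v * gen (H v) y)"
      using g by (intro star_ens_marginal ux) auto
    also have "\<dots> = gen (H b) y"
    proof -
      \<comment> \<open>Reading only \<open>f x\<close>, \<open>H\<close> factors through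
        restriction to \<open>{x0, x}\<close>, so \<open>point\<close> can be pushed forward along
        it.\<close>
      have H: "H (restrict f {x0, x}) = H f" for f
      proof -
        have "restrict f {x0, x} x = f x" by simp
        then show ?thesis by (simp only: H_def)
      qed
      have "lin I A (\<lambda>v. restrict v {x0, x}) = gen (restrict b {x0, x})"
        using point[of "{x0, x}" x] ux by (auto simp: lin_def)
      then have "push H (lin I A (\<lambda>v. restrict v {x0, x})) y = push H (gen (restrict b {x0, x})) y"
        by simp
      moreover have "push H (gen c) y = gen (H c) y" for c
        using push_lin[of "{()}" H "\<lambda>_. 1" "\<lambda>_. c"] by (simp add: lin_def)
      ultimately show ?thesis
        by (simp only: push_lin[OF finI] H) (simp only: lin_def)
    qed
    finally show "restr R (push ?sh ?V) y = 0" by simp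
  qed
  ultimately have "?V \<in> ens_filt_wr ?\<Delta> X x0 Y y0 (1 + 1)"
    using V_ens by (simp add: ens_filt_wr_def ens_filt_def topspace_wr_top)
  then show "\<exists>S\<in>ens (unbased_maps ?\<Delta> (subtopology ?Z (map_pc X x0 Y y0 a))). fissile E S \<and>
      (\<lambda>w. gen (const_map ?\<Delta> b) w - S w) \<in> ens_filt_wr ?\<Delta> X x0 Y y0 (1 + 1)"
    using S_ens fissile_star_ens by blast
qed

end
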